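(* Fix $h$, and for $1\le j\le s$ let $\alpha_j\in\mathbb N^h$ and $\beta_j\in\mathbb Z^h$ be such that $N\alpha_j+\beta_j$ is a weak composition for all sufficiently large $N$. If $\nu\in\mathbb N^h$, $\eta\in\mathbb Z^h$, and $N\nu+\eta$ is nonnegative for all sufficiently large $N$, then $$[\mathbf x^{N\nu+\eta}]\prod_{j=1}^s\kappa_{N\alpha_j+\beta_j}(\mathbf x)$$ is eventually polynomial as a function of $N$; that is, it agrees with a polynomial $P(N)$ for all sufficiently large $N$.
   Context: $\mathbb N=\{0,1,2,\dots\}$; $\mathbf x=(x_1,\dots,x_h)$; $\mathbf x^a=x_1^{a_1}\cdots x_h^{a_h}$; $[\mathbf x^a]f$ is the coefficient of $\mathbf x^a$ in $f$. A weak composition is a finite sequence of nonnegative integers. Here each $\alpha_j$ is itself a vector in $\mathbb N^h$. The isobaric divided difference (Demazure operator) is $\pi_i(f)=\dfrac{x_if-x_{i+1}s_i(f)}{x_i-x_{i+1}}$, where $s_i$ exchanges $x_i$ and $x_{i+1}$. The key polynomial $\kappa_\alpha$ of a weak composition $\alpha$ is defined by $\kappa_\alpha=\mathbf x^\alpha$ if $\alpha$ is weakly decreasing, and $\kappa_\alpha=\pi_i\,\kappa_{s_i\alpha}$ if $\alpha_i<\alpha_{i+1}$, where $s_i\alpha$ is $\alpha$ with its parts $i$ and $i+1$ exchanged (this is well defined). *)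

theory Defs
  imports
    "HOL-Library.Poly_Mapping"
    "HOL-Computational_Algebra.Polynomial"
    "HOL-Combinatorics.Transposition"
begin

section \<open>Polynomials in several variables\<close>

text \<open>
  Polynomials are elements of the monoid ring of exponent vectors over the integers.
  Variables are numbered from 0: the list entry \<open>\<alpha> ! i\<close> is the exponent of \<open>var i\<close>, so a
  list of length \<open>h\<close> is a vector with \<open>h\<close> entries, and the usual variables with indices
  \<open>1, \<dots>, h\<close> are \<open>var 0, \<dots>, var (h - 1)\<close>.
\<close>

type_synonym mpol = "(nat \<Rightarrow>\<^sub>0 nat) \<Rightarrow>\<^sub>0 int"

definition var :: "nat \<Rightarrow> mpol" where
  "var i = Poly_Mapping.single (Poly_Mapping.single i 1) 1"

definition xpow :: "nat list \<Rightarrow> mpol" where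
  "xpow a = Poly_Mapping.single (Poly_Mapping.nth a) 1"

definition xcoeff :: "nat list \<Rightarrow> mpol \<Rightarrow> int" where
  "xcoeff a f = Poly_Mapping.lookup f (Poly_Mapping.nth a)"

definition swap_exp :: "nat \<Rightarrow> (nat \<Rightarrow>\<^sub>0 nat) \<Rightarrow> (nat \<Rightarrow>\<^sub>0 nat)" where
  "swap_exp i = Poly_Mapping.map_key (transpose i (Suc i))"

definition swap_vars :: "nat \<Rightarrow> mpol \<Rightarrow> mpol" where
  "swap_vars i = Poly_Mapping.map_key (swap_exp i)"

text \<open>
  The quotient defining the Demazure operator is the unique exact quotient in the polynomial
  ring, an integral domain; see \<open>isobaric_unique\<close> and \<open>isobaric_eq\<close> below.
\<close>

definition isobaric :: "nat \<Rightarrow> mpol \<Rightarrow> mpol" where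
  "isobaric i f = (THE g. (var i - var (Suc i)) * g = var i * f - var (Suc i) * swap_vars i f)"


section \<open>Key polynomials\<close>

definition swap_parts :: "nat \<Rightarrow> 'a list \<Rightarrow> 'a list" where
  "swap_parts i \<alpha> = \<alpha>[i := \<alpha> ! Suc i, Suc i := \<alpha> ! i]"

text \<open>
  The relation allows an arbitrary ascent in every step.  That it is a total function,
  so that the description operator in \<open>key\<close> is harmless, is \<open>ex1_is_key\<close> below; the defining
  equations of \<open>key\<close> are \<open>key_decreasing\<close> and \<open>key_ascent\<close>.
\<close>

inductive is_key :: "nat list \<Rightarrow> mpol \<Rightarrow> bool" where
  decreasing: "sorted_wrt (\<ge>) \<alpha> \<Longrightarrow> is_key \<alpha> (xpow \<alpha>)"
| ascent: "Suc i < length \<alpha> \<Longrightarrow> \<alpha> ! i < \<alpha> ! Suc i \<Longrightarrow> is_key (swap_parts i \<alpha>) f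
    \<Longrightarrow> is_key \<alpha> (isobaric i f)"

definition key :: "nat list \<Rightarrow> mpol" where
  "key \<alpha> = (THE f. is_key \<alpha> f)"


section \<open>Linear families of integer vectors\<close>

definition affine_vec :: "nat list \<Rightarrow> int list \<Rightarrow> nat \<Rightarrow> int list" where
  "affine_vec \<alpha> \<beta> N = map2 (\<lambda>a b. int N * int a + b) \<alpha> \<beta>"

definition nonneg_vec :: "int list \<Rightarrow> bool" where
  "nonneg_vec \<gamma> \<longleftrightarrow> (\<forall>c\<in>set \<gamma>. 0 \<le> c)"

text \<open>Only meaningful on nonnegative vectors, since \<open>nat\<close> truncates.\<close>

definition nat_vec :: "int list \<Rightarrow> nat list" where
  "nat_vec = map nat"


section \<open>The exchange of two variables\<close>

lemma swap_exp_single [simp]: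
  "swap_exp i (Poly_Mapping.single k v) = Poly_Mapping.single (transpose i (Suc i) k) v"
proof -
  have "Poly_Mapping.map_key (transpose i (Suc i))
      (Poly_Mapping.single (transpose i (Suc i) (transpose i (Suc i) k)) v)
    = Poly_Mapping.single (transpose i (Suc i) k) v"
    by (rule map_key_single) simp
  then show ?thesis by (simp add: swap_exp_def)
qed

lemma lookup_swap_exp:
  "Poly_Mapping.lookup (swap_exp i e) k = Poly_Mapping.lookup e (transpose i (Suc i) k)"
  by (simp add: swap_exp_def map_key.rep_eq)

lemma swap_exp_swap_exp [simp]: "swap_exp i (swap_exp i e) = e"
  by (rule poly_mapping_eqI) (simp add: lookup_swap_exp)

lemma swap_exp_add: "swap_exp i (d + e) = swap_exp i d + swap_exp i e"
  by (rule poly_mapping_eqI) (simp add: lookup_swap_exp lookup_add)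

lemma inj_swap_exp [simp]: "inj (swap_exp i)"
  by (metis injI swap_exp_swap_exp)

lemma swap_vars_single [simp]:
  "swap_vars i (Poly_Mapping.single e c) = Poly_Mapping.single (swap_exp i e) c"
proof -
  have "Poly_Mapping.map_key (swap_exp i) (Poly_Mapping.single (swap_exp i (swap_exp i e)) c)
    = Poly_Mapping.single (swap_exp i e) c"
    by (rule map_key_single) simp
  then show ?thesis by (simp add: swap_vars_def)
qed

lemma lookup_swap_vars:
  "Poly_Mapping.lookup (swap_vars i f) e = Poly_Mapping.lookup f (swap_exp i e)"
  by (simp add: swap_vars_def map_key.rep_eq)

lemma swap_vars_zero [simp]: "swap_vars i 0 = 0"
  by (rule poly_mapping_eqI) (simp add: lookup_swap_vars)

lemma swap_vars_add: "swap_vars i (f + g) = swap_vars i f + swap_vars i g"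
  by (rule poly_mapping_eqI) (simp add: lookup_swap_vars lookup_add)

lemma swap_vars_diff: "swap_vars i (f - g) = swap_vars i f - swap_vars i g"
  by (rule poly_mapping_eqI) (simp add: lookup_swap_vars lookup_minus)

lemma swap_vars_swap_vars [simp]: "swap_vars i (swap_vars i f) = f"
  by (rule poly_mapping_eqI) (simp add: lookup_swap_vars)

lemma mpol_induct [case_names zero add]:
  fixes f :: mpol
  assumes "P 0" and "\<And>e c f. P f \<Longrightarrow> P (Poly_Mapping.single e c + f)"
  shows "P f"
proof (induction f rule: update_induct)
  case const
  then show ?case by (fact assms(1))
next
  case (update f a b)
  have "Poly_Mapping.update a b f = Poly_Mapping.single a b + f"
    using update(1)
    by (intro poly_mapping_eqI)
      (auto simp: lookup_update lookup_add lookup_single not_in_keys_iff_lookup_eq_zero)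
  then show ?case using assms(2) update by simp
qed

lemma swap_vars_mult: "swap_vars i (f * g) = swap_vars i f * swap_vars i g"
proof (induction f rule: mpol_induct)
  case (add e c f)
  have "swap_vars i (Poly_Mapping.single e c * g)
      = Poly_Mapping.single (swap_exp i e) c * swap_vars i g"
    by (induction g rule: mpol_induct)
      (simp_all add: distrib_left swap_vars_add mult_single swap_exp_add)
  with add show ?case by (simp add: distrib_right swap_vars_add)
qed simp

lemma swap_vars_var: "swap_vars i (var k) = var (transpose i (Suc i) k)"
  by (simp add: var_def)

lemma swap_vars_commute:
  assumes "Suc i < j"
  shows "swap_vars i (swap_vars j f) = swap_vars j (swap_vars i f)"
proof -
  have "swap_exp j (swap_exp i e) = swap_exp i (swap_exp j e)" for e
    using assms
    by (intro poly_mapping_eqI) (simp add: lookup_swap_exp transpose_def)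
  then show ?thesis by (intro poly_mapping_eqI) (simp add: lookup_swap_vars)
qed

lemma swap_vars_braid:
  "swap_vars i (swap_vars (Suc i) (swap_vars i f))
    = swap_vars (Suc i) (swap_vars i (swap_vars (Suc i) f))"
proof -
  have "swap_exp i (swap_exp (Suc i) (swap_exp i e))
      = swap_exp (Suc i) (swap_exp i (swap_exp (Suc i) e))" for e
    by (intro poly_mapping_eqI) (simp add: lookup_swap_exp transpose_def)
  then show ?thesis by (intro poly_mapping_eqI) (simp add: lookup_swap_vars)
qed


section \<open>The Demazure operators\<close>

lemma var_eq_iff: "var i = var j \<longleftrightarrow> i = j"
proof
  assume "var i = var j"
  then have "Poly_Mapping.lookup (var i) (Poly_Mapping.single j 1) = 1"
    by (simp add: var_def)
  then have "Poly_Mapping.single i (1::nat) = Poly_Mapping.single j 1"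
    by (simp add: var_def lookup_single when_def split: if_splits)
  then have "Poly_Mapping.lookup (Poly_Mapping.single i (1::nat)) j = 1" by simp
  then show "i = j" by (simp add: lookup_single when_def split: if_splits)
qed simp

lemma isobaric_unique:
  fixes g g' :: mpol
  assumes "(var i - var (Suc i)) * g = (var i - var (Suc i)) * g'"
  shows "g = g'"
  using assms var_eq_iff[of i "Suc i"] by simp

lemma single_power:
  "Poly_Mapping.single (Poly_Mapping.single k n) (1::int) = var k ^ n"
proof (induction n)
  case (Suc n)
  have "Poly_Mapping.single (Poly_Mapping.single k (Suc n)) (1::int)
      = var k * Poly_Mapping.single (Poly_Mapping.single k n) 1"
    by (simp add: var_def mult_single flip: single_add)
  with Suc show ?case by simp
qed simp

lemma isobaric_dvd: "var i - var (Suc i) dvd var i * f - var (Suc i) * swap_vars i f"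
proof (induction f rule: mpol_induct)
  case (add e c f)
  let ?x = "var i" and ?y = "var (Suc i)"
  define a b where "a = Poly_Mapping.lookup e i" and "b = Poly_Mapping.lookup e (Suc i)"
  define r where "r = e - Poly_Mapping.single i a - Poly_Mapping.single (Suc i) b"
  have r: "e = r + Poly_Mapping.single i a + Poly_Mapping.single (Suc i) b"
    by (intro poly_mapping_eqI)
      (auto simp: r_def a_def b_def lookup_add lookup_minus lookup_single when_def)
  have fix_r: "swap_exp i r = r"
    by (intro poly_mapping_eqI)
      (auto simp: lookup_swap_exp r_def a_def b_def lookup_minus lookup_single when_def
        transpose_def)
  define m :: mpol where "m = Poly_Mapping.single r c"
  have e: "Poly_Mapping.single e c = m * ?x ^ a * ?y ^ b"
    by (simp add: r m_def mult_single flip: single_power)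
  have "swap_vars i m = m" by (simp add: m_def fix_r)
  have se: "swap_vars i (Poly_Mapping.single e c) = m * ?x ^ b * ?y ^ a"
    by (simp add: r m_def mult_single swap_exp_add fix_r ac_simps flip: single_power)
  have *: "?x - ?y dvd ?x * ?x ^ a * ?y ^ b - ?y * ?x ^ b * ?y ^ a"
  proof (cases "b \<le> Suc a")
    case True
    then obtain d where d: "Suc a = b + d" using le_Suc_ex by blast
    have "?x * ?x ^ a * ?y ^ b - ?y * ?x ^ b * ?y ^ a = ?x ^ Suc a * ?y ^ b - ?x ^ b * ?y ^ Suc a"
      by (simp add: ac_simps)
    also have "\<dots> = ?x ^ b * ?y ^ b * (?x ^ d - ?y ^ d)"
      by (simp only: d power_add) (simp add: algebra_simps)
    also have "?x - ?y dvd \<dots>"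
      by (intro dvd_mult) (metis dvd_triv_left power_diff_sumr2)
    finally show ?thesis .
  next
    case False
    then obtain d where d: "b = Suc a + d" by (metis le_Suc_ex nat_le_linear)
    have "?x * ?x ^ a * ?y ^ b - ?y * ?x ^ b * ?y ^ a = ?x ^ Suc a * ?y ^ b - ?x ^ b * ?y ^ Suc a"
      by (simp add: ac_simps)
    also have "\<dots> = - (?x ^ Suc a * ?y ^ Suc a) * (?x ^ d - ?y ^ d)"
      by (simp only: d power_add) (simp add: algebra_simps)
    also have "?x - ?y dvd \<dots>"
      by (intro dvd_mult) (metis dvd_triv_left power_diff_sumr2)
    finally show ?thesis .
  qed
  have "?x * (Poly_Mapping.single e c + f) - ?y * swap_vars i (Poly_Mapping.single e c + f)
      = m * (?x * ?x ^ a * ?y ^ b - ?y * ?x ^ b * ?y ^ a)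
        + (?x * f - ?y * swap_vars i f)"
    unfolding swap_vars_add se unfolding e by (simp add: algebra_simps)
  with * add show ?case by (simp add: dvd_add)
qed simp

lemma isobaric_eq:
  "(var i - var (Suc i)) * isobaric i f = var i * f - var (Suc i) * swap_vars i f"
proof -
  obtain g where g: "(var i - var (Suc i)) * g = var i * f - var (Suc i) * swap_vars i f"
    using isobaric_dvd[of i f] by (metis dvd_def)
  then show ?thesis
    unfolding isobaric_def by (rule theI) (metis g isobaric_unique)
qed

lemma isobaric_eqI:
  "(var i - var (Suc i)) * g = var i * f - var (Suc i) * swap_vars i f \<Longrightarrow> isobaric i f = g"
  by (metis isobaric_eq isobaric_unique)

lemma swap_vars_isobaric [simp]: "swap_vars i (isobaric i f) = isobaric i f"
proof -
  have "swap_vars i ((var i - var (Suc i)) * isobaric i f)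
      = swap_vars i (var i * f - var (Suc i) * swap_vars i f)"
    by (simp only: isobaric_eq)
  then have "(var (Suc i) - var i) * swap_vars i (isobaric i f)
      = var (Suc i) * swap_vars i f - var i * f"
    by (simp add: swap_vars_mult swap_vars_diff swap_vars_var)
  then have "(var i - var (Suc i)) * swap_vars i (isobaric i f)
      = (var i - var (Suc i)) * isobaric i f"
    unfolding isobaric_eq by (simp add: algebra_simps)
  then show ?thesis by (rule isobaric_unique)
qed

lemma isobaric_commute:
  assumes "Suc i < j"
  shows "isobaric i (isobaric j f) = isobaric j (isobaric i f)"
proof -
  let ?a = "var i" and ?b = "var (Suc i)" and ?c = "var j" and ?d = "var (Suc j)"
  let ?s = "swap_vars i" and ?t = "swap_vars j"
  have tr: "transpose i (Suc i) j = j" "transpose i (Suc i) (Suc j) = Suc j"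
    "transpose j (Suc j) i = i" "transpose j (Suc j) (Suc i) = Suc i"
    using assms by (auto simp: transpose_def)
  have 1: "(?c - ?d) * ?s (isobaric j f) = ?c * ?s f - ?d * ?s (?t f)"
    using arg_cong[OF isobaric_eq[of j f], of ?s]
    by (simp add: swap_vars_mult swap_vars_diff swap_vars_var tr)
  have 2: "(?a - ?b) * ?t (isobaric i f) = ?a * ?t f - ?b * ?s (?t f)"
    using arg_cong[OF isobaric_eq[of i f], of ?t]
    by (simp add: swap_vars_mult swap_vars_diff swap_vars_var tr swap_vars_commute[OF assms])
  have "(?a - ?b) * ((?c - ?d) * isobaric i (isobaric j f))
      = (?c - ?d) * ((?a - ?b) * isobaric i (isobaric j f))"
    by (simp only: ac_simps)
  also have "\<dots> = ?a * ((?c - ?d) * isobaric j f) - ?b * ((?c - ?d) * ?s (isobaric j f))"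
    unfolding isobaric_eq[of i "isobaric j f"] by (simp add: algebra_simps)
  also have "\<dots> = ?a * (?c * f - ?d * ?t f) - ?b * (?c * ?s f - ?d * ?s (?t f))"
    by (simp only: 1 isobaric_eq)
  also have "\<dots> = ?c * (?a * f - ?b * ?s f) - ?d * (?a * ?t f - ?b * ?s (?t f))"
    by (simp add: algebra_simps)
  also have "\<dots> = ?c * ((?a - ?b) * isobaric i f) - ?d * ((?a - ?b) * ?t (isobaric i f))"
    by (simp only: 2 isobaric_eq)
  also have "\<dots> = (?a - ?b) * (?c * isobaric i f - ?d * ?t (isobaric i f))"
    by (simp add: algebra_simps)
  also have "\<dots> = (?a - ?b) * ((?c - ?d) * isobaric j (isobaric i f))"
    by (simp only: isobaric_eq)
  finally have "(?c - ?d) * isobaric i (isobaric j f) = (?c - ?d) * isobaric j (isobaric i f)"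
    by (rule isobaric_unique)
  then show ?thesis by (rule isobaric_unique)
qed

lemma isobaric_braid:
  "isobaric i (isobaric (Suc i) (isobaric i f))
    = isobaric (Suc i) (isobaric i (isobaric (Suc i) f))"
proof -
  let ?a = "var i" and ?b = "var (Suc i)" and ?c = "var (Suc (Suc i))"
  let ?s = "swap_vars i" and ?t = "swap_vars (Suc i)"
  let ?p = "isobaric i" and ?q = "isobaric (Suc i)"
  have tr: "transpose i (Suc i) (Suc (Suc i)) = Suc (Suc i)" "transpose (Suc i) (Suc (Suc i)) i = i"
    by (auto simp: transpose_def)
  note push = swap_vars_mult swap_vars_diff swap_vars_var tr
  have nz: "?a - ?b \<noteq> 0" "?b - ?c \<noteq> 0" "?a - ?c \<noteq> 0" by (simp_all add: var_eq_iff)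
  have l1: "(?a - ?b) * ?p f = ?a * f - ?b * ?s f"
    by (rule isobaric_eq)
  have l2: "(?a - ?c) * ?t (?p f) = ?a * ?t f - ?c * ?t (?s f)"
    using arg_cong[OF l1, of ?t] by (simp add: push)
  have l3: "(?b - ?c) * ?s (?t (?p f)) = ?b * ?s (?t f) - ?c * ?s (?t (?s f))"
    using arg_cong[OF l2, of ?s] by (simp add: push)
  have l4: "(?b - ?c) * ?q (?p f) = ?b * ?p f - ?c * ?t (?p f)"
    by (rule isobaric_eq)
  have l5: "(?a - ?c) * ?s (?q (?p f)) = ?a * ?p f - ?c * ?s (?t (?p f))"
    using arg_cong[OF l4, of ?s] by (simp add: push)
  have l6: "(?a - ?b) * ?p (?q (?p f)) = ?a * ?q (?p f) - ?b * ?s (?q (?p f))"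
    by (rule isobaric_eq)
  have r1: "(?b - ?c) * ?q f = ?b * f - ?c * ?t f"
    by (rule isobaric_eq)
  have r2: "(?a - ?c) * ?s (?q f) = ?a * ?s f - ?c * ?s (?t f)"
    using arg_cong[OF r1, of ?s] by (simp add: push)
  have r3: "(?a - ?b) * ?t (?s (?q f)) = ?a * ?t (?s f) - ?b * ?t (?s (?t f))"
    using arg_cong[OF r2, of ?t] by (simp add: push)
  have r4: "(?a - ?b) * ?p (?q f) = ?a * ?q f - ?b * ?s (?q f)"
    by (rule isobaric_eq)
  have r5: "(?a - ?c) * ?t (?p (?q f)) = ?a * ?q f - ?c * ?t (?s (?q f))"
    using arg_cong[OF r4, of ?t] by (simp add: push)
  have r6: "(?b - ?c) * ?q (?p (?q f)) = ?b * ?p (?q f) - ?c * ?t (?p (?q f))"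
    by (rule isobaric_eq)
  let ?R = "?a * ?b * (?a * f - ?b * ?s f) - ?a * ?c * (?a * ?t f - ?c * ?t (?s f))
    + ?b * ?c * (?b * ?s (?t f) - ?c * ?s (?t (?s f)))"
  have L: "(?a - ?b) * ((?a - ?c) * ((?b - ?c) * ?p (?q (?p f)))) = ?R"
  proof -
    have "(?a - ?b) * ((?a - ?c) * ((?b - ?c) * ?p (?q (?p f))))
        = (?a - ?c) * (?b - ?c) * ((?a - ?b) * ?p (?q (?p f)))"
      by (simp only: ac_simps)
    also have "\<dots> = ?a * (?a - ?c) * ((?b - ?c) * ?q (?p f))
        - ?b * (?b - ?c) * ((?a - ?c) * ?s (?q (?p f)))"
      unfolding l6 by (simp add: algebra_simps)
    also have "\<dots> = ?a * ?b * ((?a - ?b) * ?p f) - ?a * ?c * ((?a - ?c) * ?t (?p f))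
        + ?b * ?c * ((?b - ?c) * ?s (?t (?p f)))"
      unfolding l5 l4 by (simp add: algebra_simps)
    also have "\<dots> = ?R" by (simp only: l1 l2 l3)
    finally show ?thesis .
  qed
  have R: "(?a - ?b) * ((?a - ?c) * ((?b - ?c) * ?q (?p (?q f)))) = ?R"
  proof -
    have "(?a - ?b) * ((?a - ?c) * ((?b - ?c) * ?q (?p (?q f))))
        = ?b * (?a - ?c) * ((?a - ?b) * ?p (?q f)) - ?c * (?a - ?b) * ((?a - ?c) * ?t (?p (?q f)))"
      unfolding r6 by (simp add: algebra_simps)
    also have "\<dots> = ?a * ?a * ((?b - ?c) * ?q f) - ?b * ?b * ((?a - ?c) * ?s (?q f))
        + ?c * ?c * ((?a - ?b) * ?t (?s (?q f)))"
      unfolding r5 r4 by (simp add: algebra_simps)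
    also have "\<dots> = ?R"
      unfolding r1 r2 r3 swap_vars_braid by (simp add: algebra_simps)
    finally show ?thesis .
  qed
  from L R nz show ?thesis by (metis mult_left_cancel)
qed


section \<open>Key polynomials are well defined\<close>

lemma length_swap_parts [simp]: "length (swap_parts i \<alpha>) = length \<alpha>"
  by (simp add: swap_parts_def)

lemma nth_swap_parts:
  "Suc i < length \<alpha> \<Longrightarrow> k < length \<alpha> \<Longrightarrow> swap_parts i \<alpha> ! k = \<alpha> ! transpose i (Suc i) k"
  by (auto simp: swap_parts_def nth_list_update transpose_def)

lemma swap_parts_commute:
  "Suc i < j \<Longrightarrow> Suc j < length \<alpha> \<Longrightarrow>
    swap_parts i (swap_parts j \<alpha>) = swap_parts j (swap_parts i \<alpha>)"
  by (rule nth_equalityI) (auto simp: swap_parts_def nth_list_update)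

lemma swap_parts_braid:
  "Suc (Suc i) < length \<alpha> \<Longrightarrow>
    swap_parts i (swap_parts (Suc i) (swap_parts i \<alpha>))
      = swap_parts (Suc i) (swap_parts i (swap_parts (Suc i) \<alpha>))"
  by (rule nth_equalityI) (auto simp: swap_parts_def nth_list_update)

lemma sum_swap_parts_less:
  fixes \<alpha> :: "nat list"
  assumes "Suc i < length \<alpha>" and "\<alpha> ! i < \<alpha> ! Suc i"
  shows "(\<Sum>k<length \<alpha>. k * swap_parts i \<alpha> ! k) < (\<Sum>k<length \<alpha>. k * \<alpha> ! k)"
proof -
  let ?S = "{..<length \<alpha>} - {i, Suc i}"
  have split: "(\<Sum>k<length \<alpha>. g k) = g i + g (Suc i) + sum g ?S" for g :: "nat \<Rightarrow> nat"
  proof -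
    have "(\<Sum>k<length \<alpha>. g k) = sum g ?S + sum g {i, Suc i}"
      using assms by (intro sum.subset_diff) auto
    then show ?thesis by simp
  qed
  have "(\<Sum>k\<in>?S. k * swap_parts i \<alpha> ! k) = (\<Sum>k\<in>?S. k * \<alpha> ! k)"
    using assms by (intro sum.cong) (auto simp: nth_swap_parts transpose_def)
  moreover have "swap_parts i \<alpha> ! i = \<alpha> ! Suc i" "swap_parts i \<alpha> ! Suc i = \<alpha> ! i"
    using assms by (simp_all add: nth_swap_parts)
  ultimately show ?thesis
    using assms unfolding split by simp
qed

lemma not_decreasing_iff_ascent:
  fixes \<alpha> :: "nat list"
  shows "\<not> sorted_wrt (\<ge>) \<alpha> \<longleftrightarrow> (\<exists>i. Suc i < length \<alpha> \<and> \<alpha> ! i < \<alpha> ! Suc i)"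
proof -
  have "transp ((\<ge>) :: nat \<Rightarrow> nat \<Rightarrow> bool)" by (auto simp: transp_def)
  then show ?thesis by (auto simp: sorted_wrt_iff_nth_Suc_transp not_le)
qed

lemma ex1_is_key: "\<exists>!f. is_key \<alpha> f"
proof (induction "\<Sum>k<length \<alpha>. k * \<alpha> ! k" arbitrary: \<alpha> rule: less_induct)
  case less
  have IH: "\<exists>!f. is_key (swap_parts i \<alpha>) f" if "Suc i < length \<alpha>" "\<alpha> ! i < \<alpha> ! Suc i" for i
    using that by (intro less) (simp add: sum_swap_parts_less)
  have IH2: "\<exists>!f. is_key (swap_parts j (swap_parts i \<alpha>)) f"
    if "Suc i < length \<alpha>" "\<alpha> ! i < \<alpha> ! Suc i" "Suc j < length \<alpha>"
      "swap_parts i \<alpha> ! j < swap_parts i \<alpha> ! Suc j" for i j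
    using that sum_swap_parts_less[of i \<alpha>] sum_swap_parts_less[of j "swap_parts i \<alpha>"]
    by (intro less) simp
  have IH3: "\<exists>!f. is_key (swap_parts k (swap_parts j (swap_parts i \<alpha>))) f"
    if "Suc i < length \<alpha>" "\<alpha> ! i < \<alpha> ! Suc i" "Suc j < length \<alpha>"
      "swap_parts i \<alpha> ! j < swap_parts i \<alpha> ! Suc j" "Suc k < length \<alpha>"
      "swap_parts j (swap_parts i \<alpha>) ! k < swap_parts j (swap_parts i \<alpha>) ! Suc k" for i j k
    using that sum_swap_parts_less[of i \<alpha>] sum_swap_parts_less[of j "swap_parts i \<alpha>"]
      sum_swap_parts_less[of k "swap_parts j (swap_parts i \<alpha>)"]
    by (intro less) simp
  have confluent: "isobaric i f = isobaric j g"
    if ij: "i < j" and j: "Suc j < length \<alpha>" and ai: "\<alpha> ! i < \<alpha> ! Suc i"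
      and aj: "\<alpha> ! j < \<alpha> ! Suc j"
      and f: "is_key (swap_parts i \<alpha>) f" and g: "is_key (swap_parts j \<alpha>) g" for i j f g
  proof (cases "Suc i = j")
    case False
    with ij have ij': "Suc i < j" by simp
    have ni: "swap_parts i \<alpha> ! j < swap_parts i \<alpha> ! Suc j"
      using ij' j aj by (simp add: nth_swap_parts transpose_def)
    have nj: "swap_parts j \<alpha> ! i < swap_parts j \<alpha> ! Suc i"
      using ij' j ai by (simp add: nth_swap_parts transpose_def)
    obtain h where h: "is_key (swap_parts j (swap_parts i \<alpha>)) h"
      using IH2[of i j] ij j ai ni by auto
    have "is_key (swap_parts i \<alpha>) (isobaric j h)"
      using h ni j by (intro is_key.ascent) auto
    then have f': "f = isobaric j h" using f IH[of i] ij j ai by auto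
    have "is_key (swap_parts j \<alpha>) (isobaric i h)"
      using h nj j ij swap_parts_commute[OF ij' j] by (intro is_key.ascent) auto
    then have g': "g = isobaric i h" using g IH[of j] j aj by auto
    show ?thesis by (simp add: f' g' isobaric_commute[OF ij'])
  next
    case True
    let ?u = "swap_parts i \<alpha>" and ?v = "swap_parts j \<alpha>"
    let ?uu = "swap_parts j ?u" and ?vv = "swap_parts i ?v"
    note nth = nth_swap_parts transpose_def
    have ji: "j = Suc i" using True by simp
    have l: "Suc i < length \<alpha>" "Suc (Suc i) < length \<alpha>" using j ji by auto
    have u: "?u ! j < ?u ! Suc j" and v: "?v ! i < ?v ! Suc i"
      and uu: "?uu ! i < ?uu ! Suc i" and vv: "?vv ! j < ?vv ! Suc j"
      using ai aj l by (simp_all add: ji nth)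
    have eq: "swap_parts i ?uu = swap_parts j ?vv"
      using swap_parts_braid[of i \<alpha>] l by (simp add: ji)
    obtain h where h: "is_key (swap_parts i ?uu) h"
      using IH3[of i j i] l j ai u uu by auto
    have "is_key ?u (isobaric j (isobaric i h))"
      using h u uu l j by (intro is_key.ascent) auto
    then have f': "f = isobaric j (isobaric i h)" using f IH[of i] l ai by auto
    have "is_key ?v (isobaric i (isobaric j h))"
      using h v vv l j eq by (intro is_key.ascent) auto
    then have g': "g = isobaric i (isobaric j h)" using g IH[of j] j aj by auto
    show ?thesis by (simp add: f' g' ji isobaric_braid)
  qed
  show ?case
  proof (cases "sorted_wrt (\<ge>) \<alpha>")
    case True
    have "f = xpow \<alpha>" if "is_key \<alpha> f" for f
      using that
      by (cases rule: is_key.cases) (use True not_decreasing_iff_ascent[of \<alpha>] in auto)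
    with True show ?thesis by (blast intro: is_key.decreasing)
  next
    case False
    then obtain i where i: "Suc i < length \<alpha>" "\<alpha> ! i < \<alpha> ! Suc i"
      using not_decreasing_iff_ascent by blast
    obtain f where f: "is_key (swap_parts i \<alpha>) f" using IH[OF i] by auto
    show ?thesis
    proof (rule ex1I)
      show "is_key \<alpha> (isobaric i f)" using i f by (rule is_key.ascent)
    next
      fix g assume "is_key \<alpha> g"
      then show "g = isobaric i f"
      proof cases
        case decreasing
        with False show ?thesis by simp
      next
        case (ascent j g')
        consider "i < j" | "i = j" | "j < i" by linarith
        then show ?thesis
        proof cases
          case 1
          then show ?thesis using confluent[of i j f g'] i f ascent by simp
        next
          case 2
          then show ?thesis using IH[OF i] f ascent by auto
        next
          case 3
          then show ?thesis using confluent[of j i g' f] i f ascent by simp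
        qed
      qed
    qed
  qed
qed

lemma is_key_key: "is_key \<alpha> (key \<alpha>)"
  unfolding key_def by (rule theI') (rule ex1_is_key)

lemma key_eqI: "is_key \<alpha> f \<Longrightarrow> key \<alpha> = f"
  using is_key_key ex1_is_key by blast

lemma key_decreasing: "sorted_wrt (\<ge>) \<alpha> \<Longrightarrow> key \<alpha> = xpow \<alpha>"
  by (intro key_eqI is_key.decreasing)

lemma key_ascent:
  "Suc i < length \<alpha> \<Longrightarrow> \<alpha> ! i < \<alpha> ! Suc i \<Longrightarrow> key \<alpha> = isobaric i (key (swap_parts i \<alpha>))"
  by (intro key_eqI is_key.ascent is_key_key)

end

theory Submission
  imports Defs
    "HOL-Computational_Algebra.Polynomial_FPS"
    "HOL-Computational_Algebra.Formal_Laurent_Series"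
begin

text \<open>
  For large \<open>N\<close> the key polynomials are obtained from monomials \<open>x\<^sup>N\<^sup>\<gamma>\<^sup>+\<^sup>\<delta>\<close> by a sequence of
  Demazure operators that does not depend on \<open>N\<close>.  Their product is therefore a sum of terms
  \<open>N\<^sup>p x\<^sup>N\<^sup>\<gamma>\<^sup>+\<^sup>\<delta>\<close> divided by products of differences \<open>x\<^sub>i - x\<^sub>j\<close>.  This class of families is
  closed under taking the coefficient of an affine power of the last variable \<open>y\<close>: partial
  fractions, based on
  \<open>1 / ((x\<^sub>i - y) (x\<^sub>j - y)) = (1 / (x\<^sub>i - y) - 1 / (x\<^sub>j - y)) / (x\<^sub>j - x\<^sub>i)\<close>, leave one pole
  per term, and the coefficient of \<open>y\<^sup>M\<close> in \<open>(x\<^sub>i - y)\<^sup>-\<^sup>m\<close> is a polynomial in \<open>M\<close> times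
  \<open>x\<^sub>i\<^sup>-\<^sup>m\<^sup>-\<^sup>M\<close>.  When no variable is left, the class consists of polynomials in \<open>N\<close>.
  That only differences \<open>x\<^sub>i - x\<^sub>j\<close> occur as denominators is what excludes quasi-polynomials.
\<close>

section \<open>Partial evaluation\<close>

text \<open>
  The variables with index below \<open>k\<close> are evaluated at \<open>a\<close>; for the others the coefficient
  with exponents prescribed by \<open>n\<close> is taken.  For \<open>n = 0\<close> this sets them to zero, hence is
  multiplicative, and for \<open>k = 0\<close> it is a coefficient of \<open>f\<close>.
\<close>

definition eval_below :: "nat \<Rightarrow> (nat \<Rightarrow>\<^sub>0 nat) \<Rightarrow> mpol \<Rightarrow> (nat \<Rightarrow> rat) \<Rightarrow> rat" where
  "eval_below k n f a = (\<Sum>e\<in>Poly_Mapping.keys f.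
     if \<forall>i\<ge>k. Poly_Mapping.lookup e i = Poly_Mapping.lookup n i
     then of_int (Poly_Mapping.lookup f e) * (\<Prod>i<k. a i ^ Poly_Mapping.lookup e i) else 0)"

text \<open>Cancellation can make the keys of a sum fewer than those of its terms; a common finite
  index set makes the sums comparable.\<close>

lemma eval_below_superset:
  assumes "finite A" and "Poly_Mapping.keys f \<subseteq> A"
  shows "eval_below k n f a = (\<Sum>e\<in>A.
     if \<forall>i\<ge>k. Poly_Mapping.lookup e i = Poly_Mapping.lookup n i
     then of_int (Poly_Mapping.lookup f e) * (\<Prod>i<k. a i ^ Poly_Mapping.lookup e i) else 0)"
  unfolding eval_below_def using assms
  by (intro sum.mono_neutral_left) (auto simp: in_keys_iff)

lemma eval_below_zero [simp]: "eval_below k n 0 a = 0"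
  by (simp add: eval_below_def)

lemma eval_below_add: "eval_below k n (f + g) a = eval_below k n f a + eval_below k n g a"
proof -
  let ?A = "Poly_Mapping.keys f \<union> Poly_Mapping.keys g"
  have "Poly_Mapping.keys (f + g) \<subseteq> ?A" by (rule Poly_Mapping.keys_add)
  then show ?thesis
    by (subst (1 2 3) eval_below_superset[of ?A])
      (auto simp: lookup_add distrib_right simp flip: sum.distrib intro!: sum.cong)
qed

lemma eval_below_diff: "eval_below k n (f - g) a = eval_below k n f a - eval_below k n g a"
  using eval_below_add[of k n "f - g" g a] by simp

lemma eval_below_single:
  "eval_below k n (Poly_Mapping.single e c) a =
    (if \<forall>i\<ge>k. Poly_Mapping.lookup e i = Poly_Mapping.lookup n i
     then of_int c * (\<Prod>i<k. a i ^ Poly_Mapping.lookup e i) else 0)"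
proof (cases "c = 0")
  case False
  then have "Poly_Mapping.keys (Poly_Mapping.single e c) = {e}" by simp
  then show ?thesis unfolding eval_below_def by (simp only:) (simp del: not_all)
qed simp

text \<open>Exponents are natural numbers, so they add up to 0 only if both are 0: with
  \<open>n = 0\<close> a product of monomials is kept exactly when both factors are.\<close>

lemma eval_below_mult: "eval_below k 0 (f * g) a = eval_below k 0 f a * eval_below k 0 g a"
proof (induction f rule: mpol_induct)
  case (add e c f)
  have "eval_below k 0 (Poly_Mapping.single e c * g) a
      = eval_below k 0 (Poly_Mapping.single e c) a * eval_below k 0 g a"
  proof (induction g rule: mpol_induct)
    case (add e' c' g)
    have "eval_below k 0 (Poly_Mapping.single e c * Poly_Mapping.single e' c') a
      = eval_below k 0 (Poly_Mapping.single e c) a * eval_below k 0 (Poly_Mapping.single e' c') a"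
      by (auto simp: mult_single eval_below_single lookup_add power_add prod.distrib)
    with add show ?case by (simp add: distrib_left eval_below_add)
  qed simp
  with add show ?case by (simp add: distrib_right eval_below_add)
qed simp

lemma eval_below_one [simp]: "eval_below k 0 1 a = 1"
  using eval_below_single[of k 0 0 1 a] by simp

lemma eval_below_prod:
  "finite S \<Longrightarrow> eval_below k 0 (\<Prod>j\<in>S. f j) a = (\<Prod>j\<in>S. eval_below k 0 (f j) a)"
  by (induction S rule: finite_induct) (simp_all add: eval_below_mult)

lemma eval_below_var: "i < k \<Longrightarrow> eval_below k 0 (var i) a = a i"
proof -
  assume "i < k"
  moreover from this have "(\<Prod>j<k. a j ^ Poly_Mapping.lookup (Poly_Mapping.single i 1) j) = a i"
    by (subst prod.remove[of _ i]) (auto simp: lookup_single when_def intro!: prod.neutral)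
  ultimately show ?thesis
    unfolding var_def eval_below_single by (auto simp: lookup_single when_def)
qed

lemma eval_below_swap_vars:
  assumes "Suc i < k"
  shows "eval_below k 0 (swap_vars i f) a = eval_below k 0 f (a \<circ> transpose i (Suc i))"
proof (induction f rule: mpol_induct)
  case (add e c f)
  let ?t = "transpose i (Suc i)"
  have "(\<forall>j\<ge>k. Poly_Mapping.lookup (swap_exp i e) j = 0) \<longleftrightarrow> (\<forall>j\<ge>k. Poly_Mapping.lookup e j = 0)"
    using assms by (auto simp: lookup_swap_exp transpose_def)
  moreover have "(\<Prod>j<k. a j ^ Poly_Mapping.lookup (swap_exp i e) j)
      = (\<Prod>j<k. a (?t j) ^ Poly_Mapping.lookup e j)"
    using assms
    by (intro prod.reindex_bij_witness[of _ ?t ?t])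
      (auto simp: lookup_swap_exp transpose_def)
  ultimately show ?case
    unfolding swap_vars_add eval_below_add add.IH swap_vars_single eval_below_single
    by (simp del: not_all)
qed simp

text \<open>Without division the identity holds at every point, also where the two coordinates
  coincide.\<close>

lemma eval_below_isobaric:
  assumes "Suc i < k"
  shows "(a i - a (Suc i)) * eval_below k 0 (isobaric i f) a
    = a i * eval_below k 0 f a - a (Suc i) * eval_below k 0 f (a \<circ> transpose i (Suc i))"
proof -
  have "eval_below k 0 ((var i - var (Suc i)) * isobaric i f) a
    = eval_below k 0 (var i * f - var (Suc i) * swap_vars i f) a"
    by (simp only: isobaric_eq)
  then show ?thesis
    using assms by (simp add: eval_below_mult eval_below_diff eval_below_var eval_below_swap_vars)
qed

lemma eval_below_xpow:
  assumes "length \<gamma> = k"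
  shows "eval_below k 0 (xpow \<gamma>) a = (\<Prod>i<k. a i ^ (\<gamma> ! i))"
  using assms by (auto simp: xpow_def eval_below_single nth.rep_eq nth_default_def intro!: prod.cong)

lemma eval_below_0: "eval_below 0 n f a = of_int (Poly_Mapping.lookup f n)"
proof -
  have "eval_below 0 n f a = (\<Sum>e\<in>Poly_Mapping.keys f. if e = n then of_int (Poly_Mapping.lookup f e) else 0)"
    unfolding eval_below_def by (auto simp: poly_mapping_eq_iff fun_eq_iff intro!: sum.cong)
  then show ?thesis by (simp add: in_keys_iff)
qed

lemma eval_below_tail_0:
  "(\<And>i. i \<ge> k \<Longrightarrow> Poly_Mapping.lookup n i = 0) \<Longrightarrow> eval_below k n f a = eval_below k 0 f a"
  by (simp add: eval_below_def)

section \<open>The partial evaluation as a polynomial in the last variable\<close>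

definition last_var_poly :: "nat \<Rightarrow> (nat \<Rightarrow>\<^sub>0 nat) \<Rightarrow> mpol \<Rightarrow> (nat \<Rightarrow> rat) \<Rightarrow> rat poly" where
  "last_var_poly k n f a = (\<Sum>e\<in>Poly_Mapping.keys f.
     if \<forall>i\<ge>Suc k. Poly_Mapping.lookup e i = Poly_Mapping.lookup n i
     then monom (of_int (Poly_Mapping.lookup f e) * (\<Prod>i<k. a i ^ Poly_Mapping.lookup e i))
       (Poly_Mapping.lookup e k)
     else 0)"

lemma poly_last_var_poly:
  "poly (last_var_poly k n f a) x = eval_below (Suc k) n f (a(k := x))"
  unfolding last_var_poly_def eval_below_def poly_sum
  by (intro sum.cong refl) (auto simp: poly_monom)

text \<open>Passing from values to a coefficient of this polynomial lowers the number of evaluated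
  variables by one.\<close>

lemma coeff_last_var_poly:
  "coeff (last_var_poly k n f a) (Poly_Mapping.lookup n k) = eval_below k n f a"
proof -
  have "(\<forall>i\<ge>k. P i) \<longleftrightarrow> P k \<and> (\<forall>i\<ge>Suc k. P i)" for P
    unfolding Suc_le_eq by (auto simp: le_less)
  then show ?thesis
    unfolding last_var_poly_def eval_below_def coeff_sum
    by (intro sum.cong refl) (simp del: not_all)
qed

section \<open>Exponential-rational families\<close>

text \<open>
  A family is identified with its values at points with distinct nonzero coordinates, for
  large \<open>N\<close>, so that no junk value of \<open>powi\<close> or \<open>inverse\<close> matters.
\<close>

definition generic_point :: "nat \<Rightarrow> (nat \<Rightarrow> rat) \<Rightarrow> bool" where
  "generic_point k a \<longleftrightarrow> inj_on a {..<k} \<and> (\<forall>i<k. a i \<noteq> 0)"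

type_synonym family = "nat \<Rightarrow> (nat \<Rightarrow> rat) \<Rightarrow> rat"

definition eventually_eq :: "nat \<Rightarrow> family \<Rightarrow> family \<Rightarrow> bool" where
  "eventually_eq k F G \<longleftrightarrow> (\<forall>\<^sub>F N in sequentially. \<forall>a. generic_point k a \<longrightarrow> F N a = G N a)"

inductive exp_rational :: "nat \<Rightarrow> family \<Rightarrow> bool" for k where
  const: "exp_rational k (\<lambda>N a. c)"
| index: "exp_rational k (\<lambda>N a. of_nat N)"
| monomial: "i < k \<Longrightarrow> exp_rational k (\<lambda>N a. a i powi (int N * c + d))"
| pole: "i < k \<Longrightarrow> j < k \<Longrightarrow> i \<noteq> j \<Longrightarrow> exp_rational k (\<lambda>N a. inverse (a i - a j))"
| add: "exp_rational k F \<Longrightarrow> exp_rational k G \<Longrightarrow> exp_rational k (\<lambda>N a. F N a + G N a)"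
| mult: "exp_rational k F \<Longrightarrow> exp_rational k G \<Longrightarrow> exp_rational k (\<lambda>N a. F N a * G N a)"
| cong: "exp_rational k F \<Longrightarrow> eventually_eq k F G \<Longrightarrow> exp_rational k G"

lemma generic_point_nonzero: "generic_point k a \<Longrightarrow> i < k \<Longrightarrow> a i \<noteq> 0"
  by (simp add: generic_point_def)

lemma generic_point_distinct: "generic_point k a \<Longrightarrow> i < k \<Longrightarrow> j < k \<Longrightarrow> i \<noteq> j \<Longrightarrow> a i \<noteq> a j"
  by (auto simp: generic_point_def inj_on_def)

lemma generic_point_transpose:
  assumes "Suc i < k" and "generic_point k a"
  shows "generic_point k (a \<circ> transpose i (Suc i))"
proof -
  let ?t = "transpose i (Suc i)"
  have sub: "?t ` {..<k} \<subseteq> {..<k}" using assms(1) by (auto simp: transpose_def)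
  have "inj_on ?t {..<k}" by (rule inj_on_subset[OF inj_transpose]) simp
  moreover have "inj_on a (?t ` {..<k})"
    using assms(2) sub by (auto simp: generic_point_def intro: inj_on_subset)
  ultimately have "inj_on (a \<circ> ?t) {..<k}" by (rule comp_inj_on)
  moreover have "(a \<circ> ?t) j \<noteq> 0" if "j < k" for j
    using assms(2) sub that by (force simp: generic_point_def)
  ultimately show ?thesis by (simp add: generic_point_def)
qed

lemma eventually_eqI: "(\<And>N a. generic_point k a \<Longrightarrow> F N a = G N a) \<Longrightarrow> eventually_eq k F G"
  by (simp add: eventually_eq_def)

lemma exp_rational_diff:
  assumes "exp_rational k F" and "exp_rational k G"
  shows "exp_rational k (\<lambda>N a. F N a - G N a)"
  using exp_rational.add[OF assms(1) exp_rational.mult[OF exp_rational.const[of k "-1"] assms(2)]]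
  by simp

lemma exp_rational_var: "i < k \<Longrightarrow> exp_rational k (\<lambda>N a. a i)"
  using exp_rational.monomial[of i k 0 1] by simp

lemma exp_rational_prod:
  "finite S \<Longrightarrow> (\<And>j. j \<in> S \<Longrightarrow> exp_rational k (F j)) \<Longrightarrow> exp_rational k (\<lambda>N a. \<Prod>j\<in>S. F j N a)"
  by (induction S rule: finite_induct) (simp_all add: exp_rational.const exp_rational.mult)

lemma exp_rational_cong:
  "exp_rational k F \<Longrightarrow> (\<And>N a. generic_point k a \<Longrightarrow> F N a = G N a) \<Longrightarrow> exp_rational k G"
  by (rule exp_rational.cong, assumption, rule eventually_eqI)

text \<open>Exchanging two variables permutes the generators of the class and preserves generic
  points. This is needed for the exchanged term of a Demazure operator.\<close>

lemma exp_rational_transpose: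
  assumes "Suc i < k"
  shows "exp_rational k F \<Longrightarrow> exp_rational k (\<lambda>N a. F N (a \<circ> transpose i (Suc i)))"
proof (induction rule: exp_rational.induct)
  case (monomial j c d)
  with assms have "transpose i (Suc i) j < k" by (auto simp: transpose_def)
  then show ?case by (simp add: exp_rational.monomial)
next
  case (pole j l)
  with assms have "transpose i (Suc i) j < k" "transpose i (Suc i) l < k"
    by (auto simp: transpose_def)
  moreover from pole have "transpose i (Suc i) j \<noteq> transpose i (Suc i) l"
    by (metis transpose_involutory)
  ultimately show ?case by (simp add: exp_rational.pole)
next
  case (cong F G)
  from cong.hyps(2) have "eventually_eq k (\<lambda>N a. F N (a \<circ> transpose i (Suc i)))
      (\<lambda>N a. G N (a \<circ> transpose i (Suc i)))"
    unfolding eventually_eq_def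
    by (rule eventually_mono) (use generic_point_transpose[OF assms] in blast)
  with cong show ?case by (blast intro: exp_rational.cong)
qed (simp_all add: exp_rational.const exp_rational.index exp_rational.add exp_rational.mult)

text \<open>Points have infinitely many coordinates, but the generators see only the first
  \<open>k\<close>. Since \<open>cong\<close> leaves other values arbitrary, this holds only for
  large \<open>N\<close> and generic points. It makes coefficients constant in the last
  variable.\<close>

lemma exp_rational_local:
  "exp_rational k F \<Longrightarrow> \<forall>\<^sub>F N in sequentially. \<forall>a b. generic_point k a \<longrightarrow> (\<forall>i<k. b i = a i)
    \<longrightarrow> F N b = F N a"
proof (induction rule: exp_rational.induct)
  case (add F G)
  from add.IH show ?case by eventually_elim metis
next
  case (mult F G)
  from mult.IH show ?case by eventually_elim metis
next
  case (cong F G)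
  have *: "generic_point k b" if "generic_point k a" "\<forall>i<k. b i = a i" for a b
    using that by (auto simp: generic_point_def inj_on_def)
  from cong.hyps(2) cong.IH show ?case
    unfolding eventually_eq_def by eventually_elim (metis *)
qed auto

section \<open>Partial fractions in the last variable\<close>

text \<open>The alternative \<open>m = 0\<close> admits terms without a pole, where \<open>i\<close>
  is a dummy; for \<open>k = 0\<close> there is no other choice. Rule \<open>cong\<close> refers to
  \<open>Suc k\<close> because the last variable must be generic too.\<close>

inductive partial_fraction :: "nat \<Rightarrow> family \<Rightarrow> bool" for k where
  simple: "exp_rational k G \<Longrightarrow> i < k \<or> m = 0 \<Longrightarrow>
    partial_fraction k (\<lambda>N a. G N a * a k powi (int N * c + d) * inverse (a i - a k) ^ m)"
| add: "partial_fraction k F \<Longrightarrow> partial_fraction k G \<Longrightarrow> partial_fraction k (\<lambda>N a. F N a + G N a)"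
| cong: "partial_fraction k F \<Longrightarrow> eventually_eq (Suc k) F G \<Longrightarrow> partial_fraction k G"

lemma partial_fraction_cong:
  "partial_fraction k F \<Longrightarrow> (\<And>N a. generic_point (Suc k) a \<Longrightarrow> F N a = G N a)
    \<Longrightarrow> partial_fraction k G"
  by (rule partial_fraction.cong, assumption, rule eventually_eqI)

text \<open>Each use of the identity for a product of two poles lowers the total order
  \<open>m + n\<close> by one. The new factor \<open>inverse (a j - a i)\<close> does not involve
  the last variable and joins the coefficient.\<close>

lemma partial_fraction_two_poles:
  assumes "exp_rational k G" and "i < k \<or> m = 0" and "j < k \<or> n = 0"
  shows "partial_fraction k (\<lambda>N a. G N a * a k powi (int N * c + d)
    * inverse (a i - a k) ^ m * inverse (a j - a k) ^ n)"
  using assms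
proof (induction "m + n" arbitrary: m n G rule: less_induct)
  case less
  consider "n = 0" | "m = 0" | "i = j" | "n > 0" "m > 0" "i \<noteq> j" by blast
  then show ?case
  proof cases
    case 1
    with less show ?thesis by (simp add: partial_fraction.simple)
  next
    case 2
    with less show ?thesis by (simp add: partial_fraction.simple)
  next
    case 3
    with less have "partial_fraction k
        (\<lambda>N a. G N a * a k powi (int N * c + d) * inverse (a i - a k) ^ (m + n))"
      by (intro partial_fraction.simple) auto
    with 3 show ?thesis by (simp add: power_add ac_simps)
  next
    case 4
    then obtain m' n' where mn: "m = Suc m'" "n = Suc n'" using gr0_conv_Suc by auto
    from 4 less.prems have ij: "i < k" "j < k" "i \<noteq> j" by auto
    let ?p = "\<lambda>N a. inverse (a j - a i)"
    have pole: "exp_rational k (\<lambda>N a. inverse (a j - a i))"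
      using ij by (intro exp_rational.pole) auto
    \<comment> \<open>One factor of each pole is traded for a difference of poles: \<open>A\<close>
      has lost a pole at \<open>a j\<close>, and \<open>B\<close>, with the minus sign, one at
      \<open>a i\<close>.\<close>
    have A: "partial_fraction k (\<lambda>N a. (G N a * inverse (a j - a i)) * a k powi (int N * c + d)
        * inverse (a i - a k) ^ m * inverse (a j - a k) ^ n')"
      using ij mn less.prems by (intro less.hyps exp_rational.mult pole) auto
    have B: "partial_fraction k (\<lambda>N a. (- 1 * (G N a * inverse (a j - a i)))
        * a k powi (int N * c + d) * inverse (a i - a k) ^ m' * inverse (a j - a k) ^ n)"
      using ij mn less.prems by (intro less.hyps exp_rational.mult pole exp_rational.const) auto
    show ?thesis
    proof (rule partial_fraction_cong[OF partial_fraction.add[OF A B]], goal_cases)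
      case (1 N a)
      define u v w where "u = inverse (a i - a k)" and "v = inverse (a j - a k)"
        and "w = inverse (a j - a i)"
      have "a i - a k \<noteq> 0" "a j - a k \<noteq> 0" "a j - a i \<noteq> 0"
        using generic_point_distinct[OF 1, of i k] generic_point_distinct[OF 1, of j k]
          generic_point_distinct[OF 1, of j i] ij by auto
      then have "u * v = w * (u - v)" unfolding u_def v_def w_def by (simp add: field_simps)
      then have uv: "w * u - w * v = u * v" by (simp add: algebra_simps)
      have "g * w * x * u ^ m * v ^ n' + - 1 * (g * w) * x * u ^ m' * v ^ n
          = g * x * u ^ m * v ^ n" for g x
      proof -
        have "g * w * x * u ^ m * v ^ n' + - 1 * (g * w) * x * u ^ m' * v ^ n
            = g * x * u ^ m' * v ^ n' * (w * u - w * v)"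
          unfolding mn by (simp add: algebra_simps)
        also have "\<dots> = g * x * u ^ m * v ^ n"
          unfolding uv mn by (simp add: ac_simps)
        finally show ?thesis .
      qed
      then show ?case unfolding u_def v_def w_def by blast
    qed
  qed
qed

text \<open>By distributivity two simple terms suffice: the exponents of the last variable add up,
  and the two poles are separated by \<open>partial_fraction_two_poles\<close>.\<close>

lemma partial_fraction_mult:
  assumes "partial_fraction k F" and "partial_fraction k G"
  shows "partial_fraction k (\<lambda>N a. F N a * G N a)"
  using assms(1)
proof (induction rule: partial_fraction.induct)
  case (simple G1 i m c d)
  show ?case using assms(2)
  proof (induction rule: partial_fraction.induct)
    case (simple G2 j n c' d')
    have "partial_fraction k (\<lambda>N a. (G1 N a * G2 N a) * a k powi (int N * (c + c') + (d + d'))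
        * inverse (a i - a k) ^ m * inverse (a j - a k) ^ n)"
      using \<open>exp_rational k G1\<close> \<open>i < k \<or> m = 0\<close> simple
      by (intro partial_fraction_two_poles exp_rational.mult)
    then show ?case
    proof (rule partial_fraction_cong, goal_cases)
      case (1 N a)
      have "int N * (c + c') + (d + d') = (int N * c + d) + (int N * c' + d')"
        by (simp add: algebra_simps)
      then show ?case
        using generic_point_nonzero[OF 1, of k] by (simp add: power_int_add)
    qed
  next
    case (add F' G')
    from partial_fraction.add[OF add.IH] show ?case
      by (rule partial_fraction_cong) (simp add: distrib_left)
  next
    case (cong F' G')
    from cong.hyps(2) show ?case
      by (intro partial_fraction.cong[OF cong.IH]) (auto simp: eventually_eq_def elim: eventually_mono)
  qed
next
  case (add F' G')
  from partial_fraction.add[OF add.IH] show ?case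
    by (rule partial_fraction_cong) (simp add: distrib_right)
next
  case (cong F' G')
  from cong.hyps(2) show ?case
    by (intro partial_fraction.cong[OF cong.IH]) (auto simp: eventually_eq_def elim: eventually_mono)
qed

lemma partial_fraction_of_exp_rational: "exp_rational k F \<Longrightarrow> partial_fraction k F"
  using partial_fraction.simple[of k F 0 0 0 0] by simp

lemma partial_fraction_pole: "i < k \<Longrightarrow> partial_fraction k (\<lambda>N a. inverse (a i - a k))"
  using partial_fraction.simple[OF exp_rational.const[of k 1], of i 1 0 0] by simp

text \<open>A generator either avoids the last variable, and is a coefficient, or is a monomial or a
  pole in it, up to sign; sums and products stay in the class.\<close>

lemma exp_rational_Suc_partial_fraction: "exp_rational (Suc k) F \<Longrightarrow> partial_fraction k F"
proof (induction rule: exp_rational.induct)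
  case (monomial i c d)
  then consider "i < k" | "i = k" by linarith
  then show ?case
  proof cases
    case 2
    then show ?thesis
      using partial_fraction.simple[OF exp_rational.const[of k 1], of 0 0 c d] by simp
  qed (blast intro: partial_fraction_of_exp_rational exp_rational.monomial)
next
  case (pole i j)
  then consider "i < k" "j < k" | "i < k" "j = k" | "i = k" "j < k" by linarith
  then show ?case
  proof cases
    case 1
    with pole show ?thesis by (blast intro: partial_fraction_of_exp_rational exp_rational.pole)
  next
    case 2
    then show ?thesis by (simp add: partial_fraction_pole)
  next
    case 3
    have "inverse (a k - a j) = - 1 * inverse (a j - a k)" for a :: "nat \<Rightarrow> rat"
      by (metis inverse_minus_eq minus_diff_eq mult_minus1)
    with 3 show ?thesis
      using partial_fraction_mult[OF partial_fraction_of_exp_rational[OF exp_rational.const[of k "- 1"]]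
          partial_fraction_pole[of j k]] by simp
  qed
next
  case (cong F G)
  from cong.IH cong.hyps(2) show ?case by (rule partial_fraction.cong)
qed (simp_all add: partial_fraction_of_exp_rational exp_rational.const exp_rational.index
    partial_fraction.add partial_fraction_mult)

section \<open>Coefficient extraction\<close>

text \<open>Laurent series, because a single partial fraction may contain a negative power of the
  last variable.\<close>

definition fls_of_poly :: "rat poly \<Rightarrow> rat fls" where
  "fls_of_poly p = fps_to_fls (fps_of_poly p)"

lemma fls_of_poly_mult: "fls_of_poly (p * q) = fls_of_poly p * fls_of_poly q"
  by (simp add: fls_of_poly_def fps_of_poly_mult fls_times_fps_to_fls)

lemma fls_of_poly_add: "fls_of_poly (p + q) = fls_of_poly p + fls_of_poly q"
  by (simp add: fls_of_poly_def fps_of_poly_add)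

lemma fls_of_poly_1 [simp]: "fls_of_poly 1 = 1"
  by (simp add: fls_of_poly_def)

lemma fls_of_poly_eq_0_iff [simp]: "fls_of_poly p = 0 \<longleftrightarrow> p = 0"
  using fps_of_poly_eq_iff[of p 0] by (simp add: fls_of_poly_def)

lemma fls_of_poly_const: "fls_of_poly [:c:] = fls_const c"
  by (simp add: fls_of_poly_def fps_of_poly_const fps_const_to_fls)

lemma fls_of_poly_monom: "fls_of_poly (monom 1 n) = fls_shift (- int n) 1"
  by (simp add: fls_of_poly_def fps_of_poly_monom' fps_to_fls_power fps_X_to_fls flip: fls_X_power_conv_shift_1)

lemma nth_fls_of_poly: "fls_nth (fls_of_poly p) (int n) = coeff p n"
  by (simp add: fls_of_poly_def)

text \<open>Expansion at \<open>0\<close> of a rational function, given by its values up to finitely many exceptions.\<close>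

definition expands_to :: "(rat \<Rightarrow> rat) \<Rightarrow> rat fls \<Rightarrow> bool" where
  "expands_to f \<phi> \<longleftrightarrow> (\<exists>p q. q \<noteq> 0 \<and> (\<forall>\<^sub>F x in cofinite. f x * poly q x = poly p x)
    \<and> \<phi> * fls_of_poly q = fls_of_poly p)"

text \<open>A nonzero difference would have finitely many roots, but there are infinitely many
  rationals.\<close>

lemma eventually_cofinite_poly_eq:
  fixes p q :: "rat poly"
  assumes "\<forall>\<^sub>F x in cofinite. poly p x = poly q x"
  shows "p = q"
proof (rule ccontr)
  assume "p \<noteq> q"
  then have "finite {x. poly (p - q) x = 0}" by (intro poly_roots_finite) simp
  moreover have "finite {x. poly p x \<noteq> poly q x}" using assms by (simp add: eventually_cofinite)
  ultimately have "finite ({x. poly (p - q) x = 0} \<union> {x. poly p x \<noteq> poly q x})" by simp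
  moreover have "{x. poly (p - q) x = 0} \<union> {x. poly p x \<noteq> poly q x} = UNIV" by auto
  ultimately have "finite (UNIV :: rat set)" by (simp only:)
  then show False by (simp add: infinite_UNIV_char_0)
qed

text \<open>Two quotients representing \<open>f\<close> agree at all but finitely many points, so
  their cross products agree as polynomials; nonzero denominators cancel among Laurent
  series.\<close>

lemma expands_to_unique:
  assumes "expands_to f \<phi>" and "expands_to f \<psi>"
  shows "\<phi> = \<psi>"
proof -
  obtain p q where 1: "q \<noteq> 0" "\<forall>\<^sub>F x in cofinite. f x * poly q x = poly p x"
    "\<phi> * fls_of_poly q = fls_of_poly p"
    using assms(1) by (auto simp: expands_to_def)
  obtain p' q' where 2: "q' \<noteq> 0" "\<forall>\<^sub>F x in cofinite. f x * poly q' x = poly p' x"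
    "\<psi> * fls_of_poly q' = fls_of_poly p'"
    using assms(2) by (auto simp: expands_to_def)
  have "\<forall>\<^sub>F x in cofinite. poly (p * q') x = poly (p' * q) x"
    using 1(2) 2(2) by eventually_elim (metis mult.assoc mult.commute poly_mult)
  then have "p * q' = p' * q" by (rule eventually_cofinite_poly_eq)
  then have "fls_of_poly p * fls_of_poly q' = fls_of_poly p' * fls_of_poly q"
    by (simp flip: fls_of_poly_mult)
  then have "\<phi> * (fls_of_poly q * fls_of_poly q') = \<psi> * (fls_of_poly q * fls_of_poly q')"
    by (simp only: 1(3)[symmetric] 2(3)[symmetric] ac_simps)
  with 1(1) 2(1) show ?thesis by simp
qed

lemma expands_to_poly: "expands_to (poly p) (fls_of_poly p)"
  unfolding expands_to_def by (rule exI[of _ p], rule exI[of _ 1]) simp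

lemma expands_to_const: "expands_to (\<lambda>x. c) (fls_const c)"
proof -
  have "poly [:c:] = (\<lambda>x. c)" by (rule ext) simp
  then show ?thesis using expands_to_poly[of "[:c:]"] by (simp only: fls_of_poly_const)
qed

lemma expands_to_cong:
  assumes "expands_to f \<phi>" and "\<forall>\<^sub>F x in cofinite. f x = g x"
  shows "expands_to g \<phi>"
proof -
  obtain p q where 1: "q \<noteq> 0" "\<forall>\<^sub>F x in cofinite. f x * poly q x = poly p x"
    "\<phi> * fls_of_poly q = fls_of_poly p"
    using assms(1) by (auto simp: expands_to_def)
  from 1(2) assms(2) have "\<forall>\<^sub>F x in cofinite. g x * poly q x = poly p x"
    by eventually_elim simp
  with 1 show ?thesis by (auto simp: expands_to_def)
qed

lemma expands_to_add:
  assumes "expands_to f \<phi>" and "expands_to g \<psi>"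
  shows "expands_to (\<lambda>x. f x + g x) (\<phi> + \<psi>)"
proof -
  obtain p q where 1: "q \<noteq> 0" "\<forall>\<^sub>F x in cofinite. f x * poly q x = poly p x"
    "\<phi> * fls_of_poly q = fls_of_poly p"
    using assms(1) by (auto simp: expands_to_def)
  obtain p' q' where 2: "q' \<noteq> 0" "\<forall>\<^sub>F x in cofinite. g x * poly q' x = poly p' x"
    "\<psi> * fls_of_poly q' = fls_of_poly p'"
    using assms(2) by (auto simp: expands_to_def)
  have "\<forall>\<^sub>F x in cofinite. (f x + g x) * poly (q * q') x = poly (p * q' + p' * q) x"
    using 1(2) 2(2)
  proof eventually_elim
    case (elim x)
    show ?case by (simp add: elim[symmetric] algebra_simps)
  qed
  moreover have "(\<phi> + \<psi>) * fls_of_poly (q * q') = fls_of_poly (p * q' + p' * q)"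
    by (simp add: fls_of_poly_add fls_of_poly_mult 1(3)[symmetric] 2(3)[symmetric] algebra_simps)
  ultimately show ?thesis
    using 1(1) 2(1) unfolding expands_to_def by (metis mult_eq_0_iff)
qed

lemma expands_to_mult:
  assumes "expands_to f \<phi>" and "expands_to g \<psi>"
  shows "expands_to (\<lambda>x. f x * g x) (\<phi> * \<psi>)"
proof -
  obtain p q where 1: "q \<noteq> 0" "\<forall>\<^sub>F x in cofinite. f x * poly q x = poly p x"
    "\<phi> * fls_of_poly q = fls_of_poly p"
    using assms(1) by (auto simp: expands_to_def)
  obtain p' q' where 2: "q' \<noteq> 0" "\<forall>\<^sub>F x in cofinite. g x * poly q' x = poly p' x"
    "\<psi> * fls_of_poly q' = fls_of_poly p'"
    using assms(2) by (auto simp: expands_to_def)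
  have "\<forall>\<^sub>F x in cofinite. (f x * g x) * poly (q * q') x = poly (p * p') x"
    using 1(2) 2(2)
  proof eventually_elim
    case (elim x)
    show ?case by (simp add: elim[symmetric] ac_simps)
  qed
  moreover have "(\<phi> * \<psi>) * fls_of_poly (q * q') = fls_of_poly (p * p')"
    by (simp add: fls_of_poly_mult 1(3)[symmetric] 2(3)[symmetric] ac_simps)
  ultimately show ?thesis
    using 1(1) 2(1) unfolding expands_to_def by (metis mult_eq_0_iff)
qed

section \<open>Expansions of powers and poles\<close>

lemma eventually_cofinite_neq: "\<forall>\<^sub>F x in cofinite. x \<noteq> c"
  by (simp add: eventually_cofinite)

text \<open>\<open>fls_shift (- e) 1\<close> is the Laurent monomial with exponent
  \<open>e\<close>.\<close>

lemma expands_to_powi: "expands_to (\<lambda>x. x powi e) (fls_shift (- e) 1)"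
proof (cases "e \<ge> 0")
  case True
  then obtain n where e: "e = int n" using nonneg_int_cases by blast
  have "poly (monom 1 n) = (\<lambda>x::rat. x powi e)" by (rule ext) (simp add: e poly_monom)
  then show ?thesis
    using expands_to_poly[of "monom 1 n"] by (simp only: fls_of_poly_monom e)
next
  case False
  then have "e \<le> 0" by simp
  then obtain n where e: "e = - int n" by (rule nonpos_int_cases)
  \<comment> \<open>The point 0 is an exception: for negative \<open>e\<close> the default value of
    \<open>0 powi e\<close> is 0.\<close>
  have "\<forall>\<^sub>F x::rat in cofinite. x powi e * poly (monom 1 n) x = poly 1 x"
    using eventually_cofinite_neq[of 0]
    by eventually_elim (simp only: e poly_monom power_int_minus power_int_of_nat, simp)
  moreover have "fls_shift (- e) 1 * fls_of_poly (monom 1 n) = fls_of_poly 1"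
    using fls_X_intpow_times_fls_X_intpow[of e "int n", where ?'a = rat] by (simp add: fls_of_poly_monom e)
  moreover have "monom 1 n \<noteq> (0 :: rat poly)" by (simp add: monom_eq_0_iff)
  ultimately show ?thesis unfolding expands_to_def by blast
qed

text \<open>The expansion at 0 of \<open>(c - y) ^ m\<close> inverted. A power series suffices for
  \<open>c \<noteq> 0\<close>, when the constant coefficient \<open>c ^ m\<close> is
  invertible.\<close>

definition pole_series :: "rat \<Rightarrow> nat \<Rightarrow> rat fps" where
  "pole_series c m = inverse (fps_of_poly ([:c, -1:] ^ m))"

lemma expands_to_pole:
  assumes "c \<noteq> 0"
  shows "expands_to (\<lambda>x. inverse (c - x) ^ m) (fps_to_fls (pole_series c m))"
proof -
  have "\<forall>\<^sub>F x in cofinite. inverse (c - x) ^ m * poly ([:c, -1:] ^ m) x = poly 1 x"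
    using eventually_cofinite_neq[of c]
    by eventually_elim (simp add: poly_power power_inverse[symmetric] flip: power_mult_distrib)
  moreover have "pole_series c m * fps_of_poly ([:c, -1:] ^ m) = 1"
    unfolding pole_series_def
    by (rule inverse_mult_eq_1) (simp add: fps_of_poly_power fps_power_zeroth assms coeff_0_power)
  then have "fps_to_fls (pole_series c m) * fls_of_poly ([:c, -1:] ^ m) = fls_of_poly 1"
    by (simp add: fls_of_poly_def flip: fls_times_fps_to_fls)
  moreover have "[:c, -1:] ^ m \<noteq> 0" by simp
  ultimately show ?thesis unfolding expands_to_def by blast
qed

text \<open>The negative binomial series. With the binomial coefficient written as a product of
  \<open>r\<close> factors, it is visibly a polynomial in \<open>n\<close>.\<close>

lemma nth_pole_series:
  assumes "c \<noteq> 0"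
  shows "fps_nth (pole_series c (Suc r)) n
    = inverse (fact r) * (\<Prod>l<r. of_nat n + 1 + of_nat l) * inverse c ^ (Suc r + n)"
proof -
  have "fps_of_poly [:c, -1:] = fps_const c * (1 - fps_const (inverse c) * fps_X)"
    by (rule fps_ext) (auto simp: coeff_pCons fps_mult_fps_X_commute assms split: nat.split)
  then have "fps_of_poly ([:c, -1:] ^ Suc r)
      = fps_const (c ^ Suc r) * (1 - fps_const (inverse c) * fps_X) ^ Suc r"
    by (simp only: fps_of_poly_power power_mult_distrib fps_const_power)
  then have "pole_series c (Suc r) = fps_const (inverse c ^ Suc r)
      * inverse ((1 - fps_const (inverse c) * fps_X) ^ Suc r)"
    by (simp only: pole_series_def fps_inverse_mult fps_const_inverse power_inverse)
  then have "fps_nth (pole_series c (Suc r)) n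
      = inverse c ^ Suc r * (of_nat ((r + n) choose n) * inverse c ^ n)"
    by (simp only: one_minus_const_fps_X_neg_power'[OF zero_less_Suc] fps_mult_left_const_nth) simp
  moreover have "(of_nat ((r + n) choose n) :: rat) = inverse (fact r) * (\<Prod>l<r. of_nat n + 1 + of_nat l)"
  proof -
    \<comment> \<open>By symmetry the lower index becomes \<open>r\<close>, so the number of factors
      does not depend on \<open>n\<close>.\<close>
    have "(r + n) choose n = (r + n) choose r" by (metis add_diff_cancel_right' binomial_symmetric le_add2)
    then have "(of_nat ((r + n) choose n) :: rat) = pochhammer (of_nat n + 1) r / fact r"
      by (simp add: binomial_gbinomial gbinomial_pochhammer')
    then show ?thesis
      by (simp add: pochhammer_prod lessThan_atLeast0 field_simps)
  qed
  ultimately show ?thesis by (simp only: power_add) (simp add: ac_simps)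
qed

section \<open>Affine functions of \<open>N\<close> for large \<open>N\<close>\<close>

lemma affine_eventually_sign:
  fixes c d :: int
  obtains "\<forall>\<^sub>F N in sequentially. int N * c + d < 0"
    | "\<forall>\<^sub>F N in sequentially. int N * c + d \<ge> 0"
proof -
  consider "c < 0" | "c = 0" "d < 0" | "c = 0" "d \<ge> 0" | "c > 0" by linarith
  then show thesis
  proof cases
    case 1
    \<comment> \<open>A slope of at most -1 contributes at most \<open>- N\<close>, and
      \<open>N > \<bar>d\<bar>\<close>. For positive slope \<open>N \<ge> \<bar>d\<bar>\<close> is
      enough, since 0 is allowed there.\<close>
    have "int N * c + d < 0" if "N \<ge> nat (\<bar>d\<bar> + 1)" for N
    proof -
      have "int N * c \<le> int N * (- 1)" using 1 by (intro mult_left_mono) auto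
      with that show ?thesis by linarith
    qed
    then show thesis by (intro that(1) eventually_sequentiallyI)
  next
    case 4
    have "int N * c + d \<ge> 0" if "N \<ge> nat \<bar>d\<bar>" for N
    proof -
      have "int N * c \<ge> int N * 1" using 4 by (intro mult_left_mono) auto
      with that show ?thesis by linarith
    qed
    then show thesis by (intro that(2) eventually_sequentiallyI)
  qed (use that in simp_all)
qed

lemma affine_eventually_nonzero:
  fixes c d :: int
  assumes "c \<noteq> 0 \<or> d \<noteq> 0"
  shows "\<forall>\<^sub>F N in sequentially. int N * c + d \<noteq> 0"
proof (cases "c = 0")
  case False
  have "int N * c + d \<noteq> 0" if "N \<ge> nat (\<bar>d\<bar> + 1)" for N
  proof -
    have "\<bar>int N * c\<bar> \<ge> int N * 1"
      unfolding abs_mult using False by (intro mult_mono) auto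
    with that show ?thesis by linarith
  qed
  then show ?thesis by (rule eventually_sequentiallyI)
qed (use assms in simp)

text \<open>\<open>H\<close> gives the coefficients of \<open>F\<close>, expanded at 0 in the last
  variable, at the affine index. The series is determined by
  \<open>expands_to_unique\<close>.\<close>

definition coeff_family :: "nat \<Rightarrow> int \<Rightarrow> int \<Rightarrow> family \<Rightarrow> family \<Rightarrow> bool" where
  "coeff_family k c d F H \<longleftrightarrow> (\<forall>\<^sub>F N in sequentially. \<forall>a. generic_point k a \<longrightarrow>
    (\<exists>\<phi>. expands_to (\<lambda>x. F N (a(k := x))) \<phi> \<and> fls_nth \<phi> (int N * c + d) = H N a))"

lemma exp_rational_affine: "exp_rational k (\<lambda>N a. of_int (int N * c + d))"
  using exp_rational.add[OF exp_rational.mult[OF exp_rational.index exp_rational.const] exp_rational.const]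
  by simp

text \<open>By locality \<open>G\<close> is constant in the last variable, and the monomial shifts
  the index to \<open>?M N\<close>. A coefficient of a pole at an affine index is eventually 0 or a
  polynomial in \<open>N\<close> times an affine power of \<open>a i\<close>.\<close>

lemma coeff_family_simple:
  assumes G: "exp_rational k G" and i: "i < k \<or> m = 0"
  shows "\<exists>H. exp_rational k H \<and> coeff_family k c d
    (\<lambda>N a. G N a * a k powi (int N * c' + d') * inverse (a i - a k) ^ m) H"
proof -
  let ?M = "\<lambda>N. int N * (c - c') + (d - d')"
  \<comment> \<open>For \<open>m = 0\<close> the index \<open>i\<close> is arbitrary and
    \<open>a i\<close> may vanish, so the factor 1 is treated separately.\<close>
  define S where "S a = (if m = 0 then 1 else fps_to_fls (pole_series (a i) m))" for a :: "nat \<Rightarrow> rat"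
  have S: "expands_to (\<lambda>x. inverse ((a(k := x)) i - x) ^ m) (S a)" if "generic_point k a" for a
  proof (cases "m = 0")
    case True
    then show ?thesis using expands_to_const[of 1] by (simp add: S_def)
  next
    case False
    with i that show ?thesis
      using expands_to_pole[of "a i" m] generic_point_nonzero[of k a i] by (simp add: S_def)
  qed
  have main: "coeff_family k c d
    (\<lambda>N a. G N a * a k powi (int N * c' + d') * inverse (a i - a k) ^ m)
    (\<lambda>N a. G N a * fls_nth (S a) (?M N))"
    unfolding coeff_family_def using exp_rational_local[OF G]
  proof eventually_elim
    case (elim N)
    show ?case
    proof (intro allI impI)
      fix a assume a: "generic_point k a"
      let ?e = "int N * c' + d'"
      let ?\<phi> = "fls_const (G N a) * fls_shift (- ?e) 1 * S a"
      have "expands_to (\<lambda>x. G N a * x powi ?e * inverse ((a(k := x)) i - x) ^ m) ?\<phi>"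
        by (intro expands_to_mult expands_to_const expands_to_powi S a)
      moreover have "G N (a(k := x)) = G N a" for x
        by (rule elim[rule_format, OF a]) simp
      moreover have "fls_nth ?\<phi> (int N * c + d) = G N a * fls_nth (S a) (?M N)"
      proof -
        have "int N * c + d + - ?e = ?M N" by (simp add: algebra_simps)
        then show ?thesis
          by (simp only: mult.assoc fls_X_intpow_times_conv_shift(1) fls_mult_const_nth fls_shift_nth)
      qed
      ultimately show "\<exists>\<phi>. expands_to (\<lambda>x. G N (a(k := x)) * (a(k := x)) k powi ?e
          * inverse ((a(k := x)) i - (a(k := x)) k) ^ m) \<phi>
          \<and> fls_nth \<phi> (int N * c + d) = G N a * fls_nth (S a) (?M N)"
        by (intro exI[of _ ?\<phi>]) (simp only: fun_upd_same)
    qed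
  qed
  have "exp_rational k (\<lambda>N a. fls_nth (S a) (?M N))"
  proof (cases "c - c'" "d - d'" rule: affine_eventually_sign)
    case 1
    \<comment> \<open>Neither 1 nor a power series has terms of negative index.\<close>
    then have "eventually_eq k (\<lambda>N a. 0) (\<lambda>N a. fls_nth (S a) (?M N))"
      unfolding eventually_eq_def by eventually_elim (simp add: S_def)
    then show ?thesis by (rule exp_rational.cong[OF exp_rational.const])
  next
    case 2
    show ?thesis
    proof (cases m)
      case 0
      show ?thesis
      \<comment> \<open>The series 1 has its only nonzero coefficient at index 0; an affine index is
        either always 0 or nonzero for all large \<open>N\<close>.\<close>
      proof (cases "c - c' = 0 \<and> d - d' = 0")
        case True
        with 0 show ?thesis by (simp add: S_def exp_rational.const)
      next
        case False
        then have "\<forall>\<^sub>F N in sequentially. ?M N \<noteq> 0" by (intro affine_eventually_nonzero) simp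
        then have "eventually_eq k (\<lambda>N a. 0) (\<lambda>N a. fls_nth (S a) (?M N))"
          unfolding eventually_eq_def by eventually_elim (simp add: S_def 0)
        then show ?thesis by (rule exp_rational.cong[OF exp_rational.const])
      qed
    next
      case (Suc r)
      with i have ik: "i < k" by simp
      \<comment> \<open>This is \<open>nth_pole_series\<close> at \<open>a i\<close> with
        \<open>n\<close> replaced by \<open>?M N\<close>; the exponent is
        \<open>- (Suc r + ?M N)\<close>.\<close>
      let ?H = "\<lambda>N a. inverse (fact r) * (\<Prod>l<r. of_int (?M N) + 1 + of_nat l)
        * a i powi (int N * (- (c - c')) + (- (d - d') - int (Suc r))) :: rat"
      have "exp_rational k ?H"
        using ik by (intro exp_rational.mult exp_rational_prod exp_rational.const
          exp_rational.monomial exp_rational.add exp_rational_affine) auto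
      moreover have "eventually_eq k ?H (\<lambda>N a. fls_nth (S a) (?M N))"
        unfolding eventually_eq_def using 2
      proof eventually_elim
        case (elim N)
        then obtain n where n: "?M N = int n" using nonneg_int_cases by blast
        show ?case
        proof (intro allI impI)
          fix a assume "generic_point k a"
          then have "a i \<noteq> 0" using ik by (rule generic_point_nonzero)
          have "int N * (- (c - c')) + (- (d - d') - int (Suc r)) = - int (Suc r + n)"
            using n by (simp add: algebra_simps)
          then have "a i powi (int N * (- (c - c')) + (- (d - d') - int (Suc r)))
              = inverse (a i) ^ (Suc r + n)"
            by (simp only: power_int_minus power_int_of_nat power_inverse)
          then show "?H N a = fls_nth (S a) (?M N)"
            unfolding n using nth_pole_series[OF \<open>a i \<noteq> 0\<close>, of r n] by (simp add: S_def Suc)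
        qed
      qed
      ultimately show ?thesis by (rule exp_rational.cong)
    qed
  qed
  then show ?thesis using main G exp_rational.mult by blast
qed

text \<open>Taking a coefficient is linear, so it can be done term by term.\<close>

lemma coeff_family_partial_fraction:
  "partial_fraction k F \<Longrightarrow> \<exists>H. exp_rational k H \<and> coeff_family k c d F H"
proof (induction rule: partial_fraction.induct)
  case (simple G i m c' d')
  then show ?case by (rule coeff_family_simple)
next
  case (add F G)
  then obtain H H' where H: "exp_rational k H" "coeff_family k c d F H"
    and H': "exp_rational k H'" "coeff_family k c d G H'" by blast
  have "coeff_family k c d (\<lambda>N a. F N a + G N a) (\<lambda>N a. H N a + H' N a)"
    unfolding coeff_family_def using H(2)[unfolded coeff_family_def] H'(2)[unfolded coeff_family_def]
  proof eventually_elim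
    case (elim N)
    show ?case
    proof (intro allI impI)
      fix a assume "generic_point k a"
      with elim obtain \<phi> \<psi> where
        "expands_to (\<lambda>x. F N (a(k := x))) \<phi>" "fls_nth \<phi> (int N * c + d) = H N a"
        "expands_to (\<lambda>x. G N (a(k := x))) \<psi>" "fls_nth \<psi> (int N * c + d) = H' N a" by blast
      then show "\<exists>\<phi>. expands_to (\<lambda>x. F N (a(k := x)) + G N (a(k := x))) \<phi>
          \<and> fls_nth \<phi> (int N * c + d) = H N a + H' N a"
        by (intro exI[of _ "\<phi> + \<psi>"]) (simp add: expands_to_add)
    qed
  qed
  with H(1) H'(1) show ?case by (blast intro: exp_rational.add)
next
  case (cong F G)
  then obtain H where H: "exp_rational k H" "coeff_family k c d F H" by blast
  have "coeff_family k c d G H"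
    unfolding coeff_family_def
    using H(2)[unfolded coeff_family_def] cong.hyps(2)[unfolded eventually_eq_def]
  proof eventually_elim
    case (elim N)
    show ?case
    proof (intro allI impI)
      fix a assume a: "generic_point k a"
      with elim obtain \<phi> where \<phi>:
        "expands_to (\<lambda>x. F N (a(k := x))) \<phi>" "fls_nth \<phi> (int N * c + d) = H N a" by blast
      \<comment> \<open>For these \<open>x\<close> the extended point is not generic; being finitely
        many, they do not affect the expansion.\<close>
      have "finite (insert 0 (a ` {..<k}))" by simp
      then have "\<forall>\<^sub>F x in cofinite. x \<notin> insert 0 (a ` {..<k})" by (simp add: eventually_cofinite)
      then have "\<forall>\<^sub>F x in cofinite. F N (a(k := x)) = G N (a(k := x))"
      proof eventually_elim
        case (elim x)
        with a have "generic_point (Suc k) (a(k := x))"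
          unfolding generic_point_def
          by (auto simp: lessThan_Suc less_Suc_eq inj_on_def image_iff)
        then show ?case using \<open>\<forall>a. generic_point (Suc k) a \<longrightarrow> F N a = G N a\<close> by blast
      qed
      with \<phi> show "\<exists>\<phi>. expands_to (\<lambda>x. G N (a(k := x))) \<phi> \<and> fls_nth \<phi> (int N * c + d) = H N a"
        by (blast intro: expands_to_cong)
    qed
  qed
  with H(1) show ?case by blast
qed

text \<open>Uniqueness of expansions identifies the term-by-term coefficient with the one of the polynomial.\<close>

lemma exp_rational_coeff:
  assumes F: "exp_rational (Suc k) (\<lambda>N a. eval_below (Suc k) (n N) (f N) a)"
    and n: "\<forall>\<^sub>F N in sequentially. int (Poly_Mapping.lookup (n N) k) = int N * c + d"
  shows "exp_rational k (\<lambda>N a. eval_below k (n N) (f N) a)"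
proof -
  obtain H where H: "exp_rational k H"
    "coeff_family k c d (\<lambda>N a. eval_below (Suc k) (n N) (f N) a) H"
    using coeff_family_partial_fraction[OF exp_rational_Suc_partial_fraction[OF F]] by blast
  from H(2)[unfolded coeff_family_def] n
  have "eventually_eq k H (\<lambda>N a. eval_below k (n N) (f N) a)"
    unfolding eventually_eq_def
  proof eventually_elim
    case (elim N)
    show ?case
    proof (intro allI impI)
      fix a assume "generic_point k a"
      with elim(1) obtain \<phi> where \<phi>:
        "expands_to (\<lambda>x. eval_below (Suc k) (n N) (f N) (a(k := x))) \<phi>"
        "fls_nth \<phi> (int N * c + d) = H N a" by blast
      have "(\<lambda>x. eval_below (Suc k) (n N) (f N) (a(k := x))) = poly (last_var_poly k (n N) (f N) a)"
        by (simp add: fun_eq_iff poly_last_var_poly)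
      with \<phi>(1) have "\<phi> = fls_of_poly (last_var_poly k (n N) (f N) a)"
        using expands_to_poly expands_to_unique by metis
      then show "H N a = eval_below k (n N) (f N) a"
        using \<phi>(2) unfolding elim(2)[symmetric] by (simp add: nth_fls_of_poly coeff_last_var_poly)
    qed
  qed
  with H(1) show ?thesis by (rule exp_rational.cong)
qed

section \<open>Families of key polynomials\<close>

text \<open>Without variables there are no monomials and no poles, and every point is
  generic.\<close>

lemma exp_rational_0:
  "exp_rational 0 F \<Longrightarrow> \<exists>P :: rat poly. \<forall>\<^sub>F N in sequentially. \<forall>a. F N a = poly P (of_nat N)"
proof (induction rule: exp_rational.induct)
  case (const c)
  have "\<forall>\<^sub>F N in sequentially. \<forall>a::nat \<Rightarrow> rat. c = poly [:c:] (of_nat N)" by simp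
  then show ?case by blast
next
  case index
  have "\<forall>\<^sub>F N in sequentially. \<forall>a::nat \<Rightarrow> rat. of_nat N = poly [:0, 1::rat:] (of_nat N)" by simp
  then show ?case by blast
next
  case (add F G)
  then obtain P Q where "\<forall>\<^sub>F N in sequentially. \<forall>a. F N a = poly P (of_nat N)"
    "\<forall>\<^sub>F N in sequentially. \<forall>a. G N a = poly Q (of_nat N)" by blast
  then have "\<forall>\<^sub>F N in sequentially. \<forall>a. F N a + G N a = poly (P + Q) (of_nat N)"
    by eventually_elim simp
  then show ?case by blast
next
  case (mult F G)
  then obtain P Q where "\<forall>\<^sub>F N in sequentially. \<forall>a. F N a = poly P (of_nat N)"
    "\<forall>\<^sub>F N in sequentially. \<forall>a. G N a = poly Q (of_nat N)" by blast
  then have "\<forall>\<^sub>F N in sequentially. \<forall>a. F N a * G N a = poly (P * Q) (of_nat N)"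
    by eventually_elim simp
  then show ?case by blast
next
  case (cong F G)
  then obtain P where "\<forall>\<^sub>F N in sequentially. \<forall>a. F N a = poly P (of_nat N)" by blast
  with cong.hyps(2) have "\<forall>\<^sub>F N in sequentially. \<forall>a. G N a = poly P (of_nat N)"
    unfolding eventually_eq_def by eventually_elim (simp add: generic_point_def)
  then show ?case by blast
qed simp_all

lemma exp_rational_xpow:
  assumes len: "\<forall>\<^sub>F N in sequentially. length (\<gamma> N) = k"
    and affine: "\<And>i. i < k \<Longrightarrow> \<exists>c d. \<forall>\<^sub>F N in sequentially. int (\<gamma> N ! i) = int N * c + d"
  shows "exp_rational k (\<lambda>N a. eval_below k 0 (xpow (\<gamma> N)) a)"
proof -
  from affine obtain c d
    where cd: "\<And>i. i < k \<Longrightarrow> \<forall>\<^sub>F N in sequentially. int (\<gamma> N ! i) = int N * c i + d i"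
    by metis
  \<comment> \<open>There are finitely many coordinates, so one bound on \<open>N\<close> serves
    them all.\<close>
  then have "\<forall>\<^sub>F N in sequentially. \<forall>i\<in>{..<k}. int (\<gamma> N ! i) = int N * c i + d i"
    by (intro eventually_ball_finite) auto
  with len have "eventually_eq k (\<lambda>N a. \<Prod>i<k. a i powi (int N * c i + d i))
      (\<lambda>N a. eval_below k 0 (xpow (\<gamma> N)) a)"
    unfolding eventually_eq_def
  proof eventually_elim
    case (elim N)
    have "(\<Prod>i<k. a i powi (int N * c i + d i)) = (\<Prod>i<k. a i ^ (\<gamma> N ! i))" for a :: "nat \<Rightarrow> rat"
    proof (intro prod.cong refl)
      fix i assume "i \<in> {..<k}"
      then have "int N * c i + d i = int (\<gamma> N ! i)" using elim(2) by simp
      then show "a i powi (int N * c i + d i) = a i ^ (\<gamma> N ! i)" by simp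
    qed
    then show ?case using elim(1) by (simp add: eval_below_xpow)
  qed
  moreover have "exp_rational k (\<lambda>N a. \<Prod>i<k. a i powi (int N * c i + d i))"
    by (intro exp_rational_prod exp_rational.monomial) auto
  ultimately show ?thesis by (rule exp_rational.cong[rotated])
qed

text \<open>The divisor is a difference of two variables, so its inverse is a generator, and it is
  nonzero at generic points.\<close>

lemma exp_rational_isobaric:
  assumes i: "Suc i < k" and F: "exp_rational k (\<lambda>N a. eval_below k 0 (f N) a)"
  shows "exp_rational k (\<lambda>N a. eval_below k 0 (isobaric i (f N)) a)"
proof -
  let ?t = "transpose i (Suc i)"
  have "exp_rational k (\<lambda>N a. inverse (a i - a (Suc i))
      * (a i * eval_below k 0 (f N) a - a (Suc i) * eval_below k 0 (f N) (a \<circ> ?t)))"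
    using i by (intro exp_rational.mult exp_rational_diff exp_rational.pole exp_rational_var F
        exp_rational_transpose[OF i F]) auto
  then show ?thesis
  proof (rule exp_rational_cong)
    fix N a assume "generic_point k a"
    then have "a i - a (Suc i) \<noteq> 0" using generic_point_distinct[of k a i "Suc i"] i by simp
    then show "inverse (a i - a (Suc i))
        * (a i * eval_below k 0 (f N) a - a (Suc i) * eval_below k 0 (f N) (a \<circ> ?t))
      = eval_below k 0 (isobaric i (f N)) a"
      using eval_below_isobaric[OF i, of a "f N"] by (simp add: field_simps)
  qed
qed

text \<open>
  Beyond some \<open>N\<^sub>0\<close> the relative order of the parts no longer depends on \<open>N\<close>, so
  one and the same sequence of Demazure operators produces all the key polynomials.
\<close>

lemma exp_rational_key_stable_order:
  assumes "\<And>N. N \<ge> N0 \<Longrightarrow> length (\<gamma> N) = k"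
    and "\<And>i. i < k \<Longrightarrow> \<exists>c d. \<forall>\<^sub>F N in sequentially. int (\<gamma> N ! i) = int N * c + d"
    and "\<And>N i j. N \<ge> N0 \<Longrightarrow> i < k \<Longrightarrow> j < k \<Longrightarrow> \<gamma> N ! i < \<gamma> N ! j \<longleftrightarrow> \<gamma> N0 ! i < \<gamma> N0 ! j"
  shows "exp_rational k (\<lambda>N a. eval_below k 0 (key (\<gamma> N)) a)"
  using assms
\<comment> \<open>The measure is taken at \<open>N0\<close> alone: exchanging an ascent there lowers
  it, and the order hypothesis makes it an ascent for every later \<open>N\<close>.\<close>
proof (induction "\<Sum>l<length (\<gamma> N0). l * \<gamma> N0 ! l" arbitrary: \<gamma> rule: less_induct)
  case less
  note len = less.prems(1) and affine = less.prems(2) and order = less.prems(3)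
  show ?case
  proof (cases "sorted_wrt (\<ge>) (\<gamma> N0)")
    case True
    have "key (\<gamma> N) = xpow (\<gamma> N)" if N: "N \<ge> N0" for N
    proof (rule key_decreasing, rule ccontr)
      assume "\<not> sorted_wrt (\<ge>) (\<gamma> N)"
      then obtain i where "Suc i < k" "\<gamma> N ! i < \<gamma> N ! Suc i"
        using len[OF N] by (auto simp: not_decreasing_iff_ascent)
      then have "\<not> sorted_wrt (\<ge>) (\<gamma> N0)"
        using len[of N0] order[OF N, of i "Suc i"] not_decreasing_iff_ascent by auto
      with True show False by contradiction
    qed
    then have "eventually_eq k (\<lambda>N a. eval_below k 0 (xpow (\<gamma> N)) a)
        (\<lambda>N a. eval_below k 0 (key (\<gamma> N)) a)"
      unfolding eventually_eq_def by (intro eventually_sequentiallyI[of N0]) simp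
    moreover have "exp_rational k (\<lambda>N a. eval_below k 0 (xpow (\<gamma> N)) a)"
      using len affine by (intro exp_rational_xpow eventually_sequentiallyI[of N0])
    ultimately show ?thesis by (rule exp_rational.cong[rotated])
  next
    case False
    then obtain i where i: "Suc i < k" "\<gamma> N0 ! i < \<gamma> N0 ! Suc i"
      using len[of N0] by (auto simp: not_decreasing_iff_ascent)
    let ?t = "transpose i (Suc i)"
    let ?\<delta> = "\<lambda>N. swap_parts i (\<gamma> N)"
    have t: "?t j < k" if "j < k" for j using that i by (auto simp: transpose_def)
    have nth: "?\<delta> N ! j = \<gamma> N ! ?t j" if "N \<ge> N0" "j < k" for N j
      using that i len by (simp add: nth_swap_parts)
    have "exp_rational k (\<lambda>N a. eval_below k 0 (key (?\<delta> N)) a)"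
    proof (rule less.hyps)
      show "(\<Sum>l<length (?\<delta> N0). l * ?\<delta> N0 ! l) < (\<Sum>l<length (\<gamma> N0). l * \<gamma> N0 ! l)"
        using sum_swap_parts_less[of i "\<gamma> N0"] i len[of N0] by simp
      show "length (?\<delta> N) = k" if "N \<ge> N0" for N using len that by simp
      show "\<exists>c d. \<forall>\<^sub>F N in sequentially. int (?\<delta> N ! j) = int N * c + d" if j: "j < k" for j
      proof -
        obtain c d where "\<forall>\<^sub>F N in sequentially. int (\<gamma> N ! ?t j) = int N * c + d"
          using affine[OF t[OF j]] by blast
        then have "\<forall>\<^sub>F N in sequentially. int (?\<delta> N ! j) = int N * c + d"
          using eventually_ge_at_top[of N0] by eventually_elim (simp add: nth j)
        then show ?thesis by blast
      qed
      show "?\<delta> N ! j < ?\<delta> N ! l \<longleftrightarrow> ?\<delta> N0 ! j < ?\<delta> N0 ! l"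
        if "N \<ge> N0" "j < k" "l < k" for N j l
        unfolding nth[OF that(1,2)] nth[OF that(1,3)] nth[OF order_refl that(2)] nth[OF order_refl that(3)]
        using that by (intro order t)
    qed
    then have "exp_rational k (\<lambda>N a. eval_below k 0 (isobaric i (key (?\<delta> N))) a)"
      by (rule exp_rational_isobaric[OF i(1)])
    moreover have "eventually_eq k (\<lambda>N a. eval_below k 0 (isobaric i (key (?\<delta> N))) a)
        (\<lambda>N a. eval_below k 0 (key (\<gamma> N)) a)"
      unfolding eventually_eq_def
    proof (intro eventually_sequentiallyI[of N0] allI impI)
      fix N a assume "N \<ge> N0"
      then have "key (\<gamma> N) = isobaric i (key (?\<delta> N))"
        using i len order[of N i "Suc i"] by (intro key_ascent) auto
      then show "eval_below k 0 (isobaric i (key (?\<delta> N))) a = eval_below k 0 (key (\<gamma> N)) a" by simp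
    qed
    ultimately show ?thesis by (rule exp_rational.cong)
  qed
qed

section \<open>Affine exponent vectors and products of key polynomials\<close>

lemma length_nat_vec_affine_vec:
  "length (nat_vec (affine_vec \<alpha> \<beta> N)) = min (length \<alpha>) (length \<beta>)"
  by (simp add: nat_vec_def affine_vec_def)

lemma nth_nat_vec_affine_vec:
  assumes "nonneg_vec (affine_vec \<alpha> \<beta> N)" "i < length \<alpha>" "i < length \<beta>"
  shows "int (nat_vec (affine_vec \<alpha> \<beta> N) ! i) = int N * int (\<alpha> ! i) + \<beta> ! i"
proof -
  have "affine_vec \<alpha> \<beta> N ! i \<in> set (affine_vec \<alpha> \<beta> N)"
    using assms(2,3) by (intro nth_mem) (simp add: affine_vec_def)
  with assms(1) have "0 \<le> affine_vec \<alpha> \<beta> N ! i" by (simp add: nonneg_vec_def)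
  with assms(2,3) show ?thesis by (simp add: nat_vec_def affine_vec_def)
qed

text \<open>The difference of two parts is affine in \<open>N\<close>, so each comparison is
  eventually constant; the finitely many pairs have a common bound \<open>N0\<close>.\<close>

lemma exp_rational_key:
  assumes len: "length \<alpha> = k" "length \<beta> = k"
    and nonneg: "\<forall>\<^sub>F N in sequentially. nonneg_vec (affine_vec \<alpha> \<beta> N)"
  shows "exp_rational k (\<lambda>N a. eval_below k 0 (key (nat_vec (affine_vec \<alpha> \<beta> N))) a)"
proof -
  let ?\<gamma> = "\<lambda>N. nat_vec (affine_vec \<alpha> \<beta> N)"
  have affine: "\<forall>\<^sub>F N in sequentially. int (?\<gamma> N ! i) = int N * int (\<alpha> ! i) + \<beta> ! i" if "i < k" for i
    using nonneg by eventually_elim (use that len nth_nat_vec_affine_vec in simp)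
  have "\<exists>b. \<forall>\<^sub>F N in sequentially. (?\<gamma> N ! i < ?\<gamma> N ! j) = b" if "i < k" "j < k" for i j
  proof -
    have *: "\<forall>\<^sub>F N in sequentially. int (?\<gamma> N ! i) - int (?\<gamma> N ! j)
        = int N * (int (\<alpha> ! i) - int (\<alpha> ! j)) + (\<beta> ! i - \<beta> ! j)"
      using affine[OF that(1)] affine[OF that(2)] by eventually_elim (simp add: algebra_simps)
    show ?thesis
    proof (cases "int (\<alpha> ! i) - int (\<alpha> ! j)" "\<beta> ! i - \<beta> ! j" rule: affine_eventually_sign)
      case 1
      with * have "\<forall>\<^sub>F N in sequentially. ?\<gamma> N ! i < ?\<gamma> N ! j"
        by eventually_elim linarith
      then show ?thesis by (intro exI[of _ True]) simp
    next
      case 2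
      with * have "\<forall>\<^sub>F N in sequentially. \<not> ?\<gamma> N ! i < ?\<gamma> N ! j"
        by eventually_elim linarith
      then show ?thesis by (intro exI[of _ False]) simp
    qed
  qed
  then obtain b where "\<forall>\<^sub>F N in sequentially. (?\<gamma> N ! i < ?\<gamma> N ! j) = b i j" if "i < k" "j < k" for i j
    by metis
  then have "\<forall>\<^sub>F N in sequentially. \<forall>i\<in>{..<k}. \<forall>j\<in>{..<k}. (?\<gamma> N ! i < ?\<gamma> N ! j) = b i j"
    by (intro eventually_ball_finite ballI) auto
  then obtain N0 where N0: "\<And>N i j. N \<ge> N0 \<Longrightarrow> i < k \<Longrightarrow> j < k \<Longrightarrow> (?\<gamma> N ! i < ?\<gamma> N ! j) = b i j"
    unfolding eventually_sequentially by blast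
  show ?thesis
  proof (rule exp_rational_key_stable_order)
    show "length (?\<gamma> N) = k" if "N \<ge> N0" for N using len by (simp add: length_nat_vec_affine_vec)
    show "\<exists>c d. \<forall>\<^sub>F N in sequentially. int (?\<gamma> N ! i) = int N * c + d" if "i < k" for i
      using affine[OF that] by blast
    show "?\<gamma> N ! i < ?\<gamma> N ! j \<longleftrightarrow> ?\<gamma> N0 ! i < ?\<gamma> N0 ! j" if "N \<ge> N0" "i < k" "j < k" for N i j
      using that N0 by simp
  qed
qed

text \<open>\<open>P\<close> is rational because integer-valued polynomials, such as binomial
  coefficients, need not have integer coefficients.\<close>

theorem proposition3p3:
  fixes h s :: nat
    and \<alpha> :: "nat \<Rightarrow> nat list" and \<beta> :: "nat \<Rightarrow> int list"
    and \<nu> :: "nat list" and \<eta> :: "int list"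
  assumes "\<And>j. j \<in> {1..s} \<Longrightarrow> length (\<alpha> j) = h"
    and "\<And>j. j \<in> {1..s} \<Longrightarrow> length (\<beta> j) = h"
    and "\<And>j. j \<in> {1..s} \<Longrightarrow> \<forall>\<^sub>F N in sequentially. nonneg_vec (affine_vec (\<alpha> j) (\<beta> j) N)"
    and "length \<nu> = h" and "length \<eta> = h"
    and "\<forall>\<^sub>F N in sequentially. nonneg_vec (affine_vec \<nu> \<eta> N)"
  shows "\<exists>P :: rat poly. \<forall>\<^sub>F N in sequentially.
    of_int (xcoeff (nat_vec (affine_vec \<nu> \<eta> N))
      (\<Prod>j = 1..s. key (nat_vec (affine_vec (\<alpha> j) (\<beta> j) N)))) = poly P (of_nat N)"
proof -
  let ?f = "\<lambda>N. \<Prod>j = 1..s. key (nat_vec (affine_vec (\<alpha> j) (\<beta> j) N))"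
  let ?\<mu> = "\<lambda>N. nat_vec (affine_vec \<nu> \<eta> N)"
  let ?n = "\<lambda>N. Poly_Mapping.nth (?\<mu> N)"
  have len: "length (?\<mu> N) = h" for N using assms by (simp add: length_nat_vec_affine_vec)
  \<comment> \<open>With all \<open>h\<close> variables evaluated, partial evaluation is
    multiplicative, so the factors are treated separately.\<close>
  have "exp_rational h (\<lambda>N a. \<Prod>j = 1..s. eval_below h 0 (key (nat_vec (affine_vec (\<alpha> j) (\<beta> j) N))) a)"
    using assms by (intro exp_rational_prod exp_rational_key) auto
  \<comment> \<open>The exponent vector vanishes from \<open>h\<close> on, where \<open>?n N\<close>
    and 0 thus prescribe the same exponents.\<close>
  moreover have "eval_below h (?n N) (?f N) a = eval_below h 0 (?f N) a" for N a
    by (rule eval_below_tail_0) (simp add: nth.rep_eq nth_default_def len)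
  ultimately have top: "exp_rational h (\<lambda>N a. eval_below h (?n N) (?f N) a)"
    by (simp only: eval_below_prod finite_atLeastAtMost)
  \<comment> \<open>\<open>m\<close> counts the variables whose coefficient has been taken,
    beginning with the last one.\<close>
  have "exp_rational (h - m) (\<lambda>N a. eval_below (h - m) (?n N) (?f N) a)" if "m \<le> h" for m
    using that
  proof (induction m)
    case 0
    then show ?case using top by simp
  next
    case (Suc m)
    define k where "k = h - Suc m"
    with Suc.prems have k: "h - m = Suc k" "k < h" by auto
    have "\<forall>\<^sub>F N in sequentially. int (Poly_Mapping.lookup (?n N) k) = int N * int (\<nu> ! k) + \<eta> ! k"
      using assms(6)
      by eventually_elim (use k assms(4,5) in \<open>simp add: nth.rep_eq nth_default_nth len nth_nat_vec_affine_vec\<close>)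
    moreover have "exp_rational (Suc k) (\<lambda>N a. eval_below (Suc k) (?n N) (?f N) a)"
      using Suc by (simp add: k(1))
    ultimately show ?case unfolding k_def[symmetric] by (rule exp_rational_coeff[rotated])
  qed
  from this[of h] have "exp_rational 0 (\<lambda>N a. eval_below 0 (?n N) (?f N) a)" by simp
  from exp_rational_0[OF this] show ?thesis by (simp add: eval_below_0 xcoeff_def)
qed

end
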